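(* A poset $\mathcal P$ is of type $\mathbb A$ if and only if there exist a Dynkin quiver $Q$ of type $\mathbb A$ and an alien set $F$ for $Q$ such that $\mathcal P=\mathcal P_{Q^F}$ is the poset associated to the quiver $Q^F$.
   Context: Posets. All posets are finite. $\max\mathcal P$ is the set of maximal points of a poset $\mathcal P$. A full subposet $\mathcal P'\subseteq\mathcal P$ is a peak-subposet if $\max\mathcal P'\subseteq\max\mathcal P$. A finite connected poset $\mathcal P$ is of type $\mathbb A$ if no peak-subposet of $\mathcal P$ is isomorphic to one of the following posets (points called $\star$ are the maximal points; the only strict relations are the listed ones and those implied by transitivity): $\mathcal R_1$: one maximal point $\star$ and three pairwise incomparable points, each $\prec\star$. $\mathcal R_2$: two maximal points $\star,\star'$ and two points $a\prec b$ with $b\prec\star$, $b\prec\star'$. $\mathcal R_3$: three maximal points and one point below all three. $\mathcal R_{4,n}$ ($n\ge 0$): maximal points $\star_1,\dots,\star_{n+2}$ and pairwise incomparable points $c_1,\dots,c_{n+2}$ with $c_1\prec\star_1$, $c_1\prec\star_{n+2}$ and $c_i\prec\star_{i-1}$, $c_i\prec\star_i$ for $2\le i\le n+2$. Quivers. A Dynkin quiver of type $\mathbb A$ is any orientation of a path graph with $n\ge1$ vertices; its extremal vertices are the end vertices of the path. A sink (source) is a vertex at which no arrow starts (ends). $s(\alpha)$, $t(\alpha)$ are the starting and target vertices of an arrow $\alpha$. For a sink $z$ of $Q$, $\operatorname{Supp} I(z)$ is the support of the indecomposable injective representation at $z$, i.e. the set of vertices from which there is a (possibly trivial) path to $z$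 in $Q$. For a finite acyclic quiver $Q$, the poset $\mathcal P_Q$ associated to $Q$ is the set of vertices $Q_0$ ordered by $x\preceq y$ iff there is a path from $x$ to $y$ in $Q$. Alien sets. Let $Q$ be a Dynkin quiver of type $\mathbb A$. For a finite set $F$ of new arrows between vertices of $Q$, let $Q^F$ be the quiver with vertices $Q_0$ and arrows $Q_1\cup F$. $F$ (possibly empty) is an alien set for $Q$ if: (a) for each $\alpha\in F$ there is a sink $z$ of $Q$ with $s(\alpha),t(\alpha)\in\operatorname{Supp} I(z)$; (b) for each $\alpha\in F$, $t(\alpha)$ is not a source of $Q$ unless it is an extremal vertex of $Q$; (c) for each $\alpha\in F$, $\alpha$ is the unique path from $s(\alpha)$ to $t(\alpha)$ in $Q^F$; (d) $Q^F$ is acyclic. *)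

theory Defs
  imports "Graph_Theory.Graph_Theory"
begin

section \<open>Posets of type A\<close>

text \<open>
  A poset is a pair of a carrier \<open>P\<close> and a relation \<open>r\<close> with
  \<open>partial_order_on P r\<close>; \<open>(x, y) \<in> r\<close> means \<open>x \<preceq> y\<close>.
\<close>

definition max_points :: "'a set \<Rightarrow> 'a rel \<Rightarrow> 'a set" where
  "max_points P r = {x \<in> P. \<forall>y \<in> P. (x, y) \<in> r \<longrightarrow> y = x}"

definition poset_isomorphic :: "'a set \<Rightarrow> 'a rel \<Rightarrow> 'b set \<Rightarrow> 'b rel \<Rightarrow> bool" where
  "poset_isomorphic P r P' r' \<longleftrightarrow>
     (\<exists>f. bij_betw f P P' \<and> (\<forall>x \<in> P. \<forall>y \<in> P. (x, y) \<in> r \<longleftrightarrow> (f x, f y) \<in> r'))"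

text \<open>The empty poset is not connected.\<close>

definition connected_poset :: "'a set \<Rightarrow> 'a rel \<Rightarrow> bool" where
  "connected_poset P r \<longleftrightarrow> P \<noteq> {} \<and> (\<forall>x \<in> P. \<forall>y \<in> P. (x, y) \<in> (Restr (r \<union> r\<inverse>) P)\<^sup>*)"

text \<open>The full subposet of \<open>(P, r)\<close> on \<open>S\<close> is \<open>(S, Restr r S)\<close>.\<close>

definition peak_subposet :: "'a set \<Rightarrow> 'a set \<Rightarrow> 'a rel \<Rightarrow> bool" where
  "peak_subposet S P r \<longleftrightarrow> S \<subseteq> P \<and> max_points S (Restr r S) \<subseteq> max_points P r"

definition has_peak_subposet :: "'a set \<Rightarrow> 'a rel \<Rightarrow> 'b set \<Rightarrow> 'b rel \<Rightarrow> bool" where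
  "has_peak_subposet P r R rR \<longleftrightarrow>
     (\<exists>S. peak_subposet S P r \<and> poset_isomorphic S (Restr r S) R rR)"

text \<open>
  Points of the excluded posets: \<open>Star i\<close> are the maximal ones, \<open>Pt i\<close> the others.
\<close>

datatype point = Star nat | Pt nat

definition generated_order :: "'a set \<Rightarrow> 'a rel \<Rightarrow> 'a rel" where
  "generated_order P g = Restr (g\<^sup>*) P"

definition R1_points :: "point set" where
  "R1_points = {Star 1, Pt 1, Pt 2, Pt 3}"

definition R1_order :: "point rel" where
  "R1_order = generated_order R1_points
     {(Pt 1, Star 1), (Pt 2, Star 1), (Pt 3, Star 1)}"

text \<open>In \<open>R2\<close>, the points \<open>a\<close> and \<open>b\<close> are \<open>Pt 1\<close> and \<open>Pt 2\<close>.\<close>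

definition R2_points :: "point set" where
  "R2_points = {Star 1, Star 2, Pt 1, Pt 2}"

definition R2_order :: "point rel" where
  "R2_order = generated_order R2_points
     {(Pt 1, Pt 2), (Pt 2, Star 1), (Pt 2, Star 2)}"

definition R3_points :: "point set" where
  "R3_points = {Star 1, Star 2, Star 3, Pt 1}"

definition R3_order :: "point rel" where
  "R3_order = generated_order R3_points
     {(Pt 1, Star 1), (Pt 1, Star 2), (Pt 1, Star 3)}"

definition R4_points :: "nat \<Rightarrow> point set" where
  "R4_points n = Star ` {1..n+2} \<union> Pt ` {1..n+2}"

definition R4_order :: "nat \<Rightarrow> point rel" where
  "R4_order n = generated_order (R4_points n)
     ({(Pt 1, Star 1), (Pt 1, Star (n+2))}
      \<union> (\<Union>i \<in> {2..n+2}. {(Pt i, Star (i - 1)), (Pt i, Star i)}))"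

definition poset_type_A :: "'a set \<Rightarrow> 'a rel \<Rightarrow> bool" where
  "poset_type_A P r \<longleftrightarrow>
     finite P \<and> partial_order_on P r \<and> connected_poset P r \<and>
     \<not> has_peak_subposet P r R1_points R1_order \<and>
     \<not> has_peak_subposet P r R2_points R2_order \<and>
     \<not> has_peak_subposet P r R3_points R3_order \<and>
     (\<forall>n. \<not> has_peak_subposet P r (R4_points n) (R4_order n))"


section \<open>Quivers\<close>

text \<open>
  A quiver is a \<open>pre_digraph\<close>, with \<open>tail\<close> and \<open>head\<close> as starting and target vertex;
  multiple arrows and loops are allowed. The paths from \<open>x\<close> to \<open>y\<close>, including the trivial
  one if \<open>x = y\<close>, are the lists \<open>p\<close> of arrows with \<open>pre_digraph.awalk Q x p y\<close>.
\<close>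

text \<open>
  \<open>path_enumeration Q vs\<close>: the underlying graph of \<open>Q\<close> is the path graph with successive
  vertices \<open>vs\<close>; \<open>e i\<close> is the arrow (in either direction) between the \<open>i\<close>-th vertex
  and the next one.
\<close>

definition path_enumeration :: "('a, 'b) pre_digraph \<Rightarrow> 'a list \<Rightarrow> bool" where
  "path_enumeration Q vs \<longleftrightarrow>
     vs \<noteq> [] \<and> distinct vs \<and> set vs = verts Q \<and>
     (\<exists>e. bij_betw e {..<length vs - 1} (arcs Q) \<and>
          (\<forall>i < length vs - 1. {tail Q (e i), head Q (e i)} = {vs ! i, vs ! Suc i}))"

definition dynkin_quiver_A :: "('a, 'b) pre_digraph \<Rightarrow> bool" where
  "dynkin_quiver_A Q \<longleftrightarrow> (\<exists>vs. path_enumeration Q vs)"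

definition extremal_vertex :: "('a, 'b) pre_digraph \<Rightarrow> 'a \<Rightarrow> bool" where
  "extremal_vertex Q v \<longleftrightarrow> (\<exists>vs. path_enumeration Q vs \<and> (v = hd vs \<or> v = last vs))"

definition is_sink :: "('a, 'b) pre_digraph \<Rightarrow> 'a \<Rightarrow> bool" where
  "is_sink Q v \<longleftrightarrow> v \<in> verts Q \<and> out_arcs Q v = {}"

definition is_source :: "('a, 'b) pre_digraph \<Rightarrow> 'a \<Rightarrow> bool" where
  "is_source Q v \<longleftrightarrow> v \<in> verts Q \<and> in_arcs Q v = {}"

text \<open>The support of the indecomposable injective representation at \<open>z\<close>.\<close>

definition supp_I :: "('a, 'b) pre_digraph \<Rightarrow> 'a \<Rightarrow> 'a set" where
  "supp_I Q z = {x \<in> verts Q. \<exists>p. pre_digraph.awalk Q x p z}"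

definition acyclic_quiver :: "('a, 'b) pre_digraph \<Rightarrow> bool" where
  "acyclic_quiver Q \<longleftrightarrow> (\<nexists>p. pre_digraph.cycle Q p)"

text \<open>
  The order of the poset \<open>P_Q\<close> on \<open>verts Q\<close>; it is antisymmetric if \<open>Q\<close> is acyclic.
\<close>

definition quiver_order :: "('a, 'b) pre_digraph \<Rightarrow> 'a rel" where
  "quiver_order Q = {(x, y). \<exists>p. pre_digraph.awalk Q x p y}"


section \<open>Alien sets\<close>

text \<open>
  The new arrows are given by a set \<open>F\<close> of names not used by the arrows of \<open>Q\<close>, together with
  the maps \<open>s\<close> and \<open>t\<close> assigning to them their starting and target vertices.
\<close>

definition add_arrows ::
    "('a, 'b) pre_digraph \<Rightarrow> 'b set \<Rightarrow> ('b \<Rightarrow> 'a) \<Rightarrow> ('b \<Rightarrow> 'a) \<Rightarrow> ('a, 'b) pre_digraph" where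
  "add_arrows Q F s t =
     \<lparr> verts = verts Q,
       arcs = arcs Q \<union> F,
       tail = (\<lambda>\<alpha>. if \<alpha> \<in> F then s \<alpha> else tail Q \<alpha>),
       head = (\<lambda>\<alpha>. if \<alpha> \<in> F then t \<alpha> else head Q \<alpha>) \<rparr>"

definition alien_set ::
    "('a, 'b) pre_digraph \<Rightarrow> 'b set \<Rightarrow> ('b \<Rightarrow> 'a) \<Rightarrow> ('b \<Rightarrow> 'a) \<Rightarrow> bool" where
  "alien_set Q F s t \<longleftrightarrow>
     finite F \<and> F \<inter> arcs Q = {} \<and> s ` F \<subseteq> verts Q \<and> t ` F \<subseteq> verts Q \<and>
     (\<forall>\<alpha> \<in> F. \<exists>z. is_sink Q z \<and> s \<alpha> \<in> supp_I Q z \<and> t \<alpha> \<in> supp_I Q z) \<and>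
     (\<forall>\<alpha> \<in> F. is_source Q (t \<alpha>) \<longrightarrow> extremal_vertex Q (t \<alpha>)) \<and>
     (\<forall>\<alpha> \<in> F. \<forall>p. pre_digraph.awalk (add_arrows Q F s t) (s \<alpha>) p (t \<alpha>) \<longleftrightarrow> p = [\<alpha>]) \<and>
     acyclic_quiver (add_arrows Q F s t)"

end

theory Submission
  imports Defs
begin

text \<open>
  Excluding \<open>R3\<close> and \<open>R2\<close> means that a point lies below at most two maximal points, and that it
  is minimal if it lies below two. Hence the maximal points form a graph whose edges are the shared
  points; excluding \<open>R1\<close> bounds the degrees by two and excluding the crowns \<open>R4\<close> excludes cycles and
  double edges, so by connectedness this graph is a path. The points strictly below a maximal
  point have width at most two and split into two chains, in which the shared points are the two
  bottoms. Concatenating these chains along the path gives \<open>Q\<close>, and the covering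
  relations which are not arrows of \<open>Q\<close> form the alien set.

  Conversely, alien arrows create no new path to a sink of \<open>Q\<close> and never end in a source between
  two sinks. So the maximal points are the sinks of \<open>Q\<close>, the points below a sink form an interval of
  the path, which is a union of two chains, and the points shared by two sinks are minimal and lie
  between them; the rightmost maximal point of a crown would have two incomparable shared points on
  its left.
\<close>

section \<open>Excluded subposets\<close>

text \<open>Condition (c) allows an alien arrow only on a covering relation, and the arrows must
  generate \<open>r\<close>; so once \<open>Q\<close> is chosen, the alien set is determined up to
  names: the covers that \<open>Q\<close> lacks. Arrows of \<open>Q\<close> are not subject to (c)
  and need not be covers, so any suitable decomposition into two chains will do. What
  \<open>Q\<close> has to provide is (a), that everything below a maximal point reaches it inside
  \<open>Q\<close>, and (b). The obstacle is the gluing: consecutive blocks of the path overlap in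
  their shared point, which must be the outer end of its chain, on the correct side. Minimality
  achieves this: two different minimal points are incomparable, so they fall into different chains,
  each as the bottom. The only other outer ends are the ends of the path, which is the exception
  made in (b). In the converse, (b) confines the alien arrows: a vertex that reaches two sinks in
  \<open>Q\<close> is a source inside the path, hence not the target of an alien arrow. So such a
  target reaches only one sink, the one that (a) provides for the starting vertex as well.\<close>

text \<open>Since \<open>g\<close> preserves and reflects the order, maximal points of the image
  come from maximal points of the pattern; only these have to be checked in
  \<open>P\<close>.\<close>

lemma has_peak_subposetI:
  assumes "inj_on g R" "g ` R \<subseteq> P"
    and ord: "\<And>x y. x \<in> R \<Longrightarrow> y \<in> R \<Longrightarrow> (g x, g y) \<in> r \<longleftrightarrow> (x, y) \<in> rR"
    and max: "\<And>x. x \<in> max_points R rR \<Longrightarrow> g x \<in> max_points P r"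
  shows "has_peak_subposet P r R rR"
proof -
  let ?S = "g ` R"
  have "max_points ?S (Restr r ?S) \<subseteq> max_points P r"
  proof
    fix y assume y: "y \<in> max_points ?S (Restr r ?S)"
    then obtain x where x: "x \<in> R" "y = g x" by (auto simp: max_points_def)
    have "x \<in> max_points R rR"
      using y x ord inj_onD[OF \<open>inj_on g R\<close>] by (fastforce simp: max_points_def)
    with max x show "y \<in> max_points P r" by simp
  qed
  moreover have "poset_isomorphic ?S (Restr r ?S) R rR"
    unfolding poset_isomorphic_def
  proof (intro exI conjI ballI)
    show "bij_betw (inv_into R g) ?S R"
      using assms(1) by (simp add: bij_betw_inv_into inj_on_imp_bij_betw)
    fix x y assume "x \<in> ?S" "y \<in> ?S"
    then show "(x, y) \<in> Restr r ?S \<longleftrightarrow> (inv_into R g x, inv_into R g y) \<in> rR"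
      using assms(1) ord by auto
  qed
  ultimately show ?thesis
    using assms(2) unfolding has_peak_subposet_def peak_subposet_def by blast
qed

lemma has_peak_subposetE:
  assumes "has_peak_subposet P r R rR"
  obtains g where "inj_on g R" "g ` R \<subseteq> P"
    "\<And>x y. x \<in> R \<Longrightarrow> y \<in> R \<Longrightarrow> (g x, g y) \<in> r \<longleftrightarrow> (x, y) \<in> rR"
    "\<And>x. x \<in> max_points R rR \<Longrightarrow> g x \<in> max_points P r"
proof -
  obtain S f where S: "S \<subseteq> P" "max_points S (Restr r S) \<subseteq> max_points P r"
    and f: "bij_betw f S R" "\<And>x y. x \<in> S \<Longrightarrow> y \<in> S \<Longrightarrow> (x, y) \<in> Restr r S \<longleftrightarrow> (f x, f y) \<in> rR"
    using assms unfolding has_peak_subposet_def peak_subposet_def poset_isomorphic_def by blast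
  define g where "g = inv_into S f"
  have g: "bij_betw g R S" using f(1) by (simp add: g_def bij_betw_inv_into)
  have gS: "g x \<in> S" if "x \<in> R" for x using g that by (auto simp: bij_betw_def)
  have fg: "f (g x) = x" if "x \<in> R" for x
    using f(1) that by (simp add: g_def bij_betw_inv_into_right)
  have ord: "(g x, g y) \<in> r \<longleftrightarrow> (x, y) \<in> rR" if "x \<in> R" "y \<in> R" for x y
    using f(2)[of "g x" "g y"] gS fg that by auto
  show thesis
  proof
    show "inj_on g R" "g ` R \<subseteq> P" using g S(1) by (auto simp: bij_betw_def)
    show "\<And>x y. x \<in> R \<Longrightarrow> y \<in> R \<Longrightarrow> (g x, g y) \<in> r \<longleftrightarrow> (x, y) \<in> rR" by (fact ord)
    fix x assume x: "x \<in> max_points R rR"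
    have "g x \<in> max_points S (Restr r S)"
      unfolding max_points_def
    proof (intro CollectI conjI ballI impI)
      show "g x \<in> S" using x gS by (auto simp: max_points_def)
      fix y assume y: "y \<in> S" "(g x, y) \<in> Restr r S"
      then obtain w where "w \<in> R" "y = g w" using g by (auto simp: bij_betw_def)
      then show "y = g x" using x y ord by (auto simp: max_points_def)
    qed
    then show "g x \<in> max_points P r" using S(2) by blast
  qed
qed

lemma rtrancl_eqI:
  assumes "g \<subseteq> h" "h \<subseteq> g\<^sup>*" "Id \<subseteq> h" "trans h"
  shows "g\<^sup>* = h"
proof
  show "g\<^sup>* \<subseteq> h"
  proof (rule subrelI)
    fix x y assume "(x, y) \<in> g\<^sup>*"
    then show "(x, y) \<in> h"
      by induction (use assms in \<open>auto dest: transD\<close>)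
  qed
qed (fact assms(2))

text \<open>No two generators can be composed, so the closure adds nothing but the diagonal.\<close>

lemma generated_order_bipartite:
  assumes "Range g \<inter> Domain g = {}"
  shows "generated_order P g = Restr (Id \<union> g) P"
proof -
  have "g\<^sup>* = Id \<union> g"
    by (rule rtrancl_eqI) (use assms in \<open>auto simp: trans_def\<close>)
  then show ?thesis by (simp add: generated_order_def)
qed

lemma R1_order_iff:
  "(x, y) \<in> R1_order \<longleftrightarrow> x \<in> R1_points \<and> y \<in> R1_points \<and> (x = y \<or> y = Star 1)"
  unfolding R1_order_def by (subst generated_order_bipartite) (auto simp: R1_points_def)

lemma R2_order_iff:
  "(x, y) \<in> R2_order \<longleftrightarrow>
     x \<in> R2_points \<and> y \<in> R2_points \<and> (x = y \<or> x = Pt 1 \<or> x = Pt 2 \<and> y \<noteq> Pt 1)"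
proof -
  let ?g = "{(Pt 1, Pt 2), (Pt 2, Star 1), (Pt 2, Star 2)}"
  \<comment> \<open>This is the only pattern with a chain of three points; the two composed pairs
    are the ones through \<open>Pt 2\<close>.\<close>
  have "?g\<^sup>* = Id \<union> (?g \<union> {(Pt 1, Star 1), (Pt 1, Star 2)})"
    by (rule rtrancl_eqI) (auto simp: trans_def intro: converse_rtrancl_into_rtrancl[where b = "Pt 2"])
  then show ?thesis
    unfolding R2_order_def generated_order_def by (auto simp: R2_points_def)
qed

lemma R3_order_iff:
  "(x, y) \<in> R3_order \<longleftrightarrow> x \<in> R3_points \<and> y \<in> R3_points \<and> (x = y \<or> x = Pt 1)"
  unfolding R3_order_def by (subst generated_order_bipartite) (auto simp: R3_points_def)

text \<open>The incidences are cyclic: \<open>Pt i\<close> is below the stars \<open>i\<close> and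
  \<open>i - 1\<close>, where the predecessor of \<open>1\<close> is \<open>n + 2\<close>. The case
  \<open>Suc j = i\<close> is harmless for \<open>i = 1\<close>, as there is no
  \<open>Star 0\<close>.\<close>

lemma R4_order_iff:
  "(x, y) \<in> R4_order n \<longleftrightarrow> x \<in> R4_points n \<and> y \<in> R4_points n \<and>
     (x = y \<or> (\<exists>i j. x = Pt i \<and> y = Star j \<and> (j = i \<or> Suc j = i \<or> i = 1 \<and> j = n + 2)))"
proof -
  let ?g = "{(Pt 1, Star 1), (Pt 1, Star (n+2))}
      \<union> (\<Union>i \<in> {2..n+2}. {(Pt i, Star (i - 1)), (Pt i, Star i)})"
  have "(x, y) \<in> ?g \<longleftrightarrow> (\<exists>i j. x = Pt i \<and> y = Star j \<and> (j = i \<or> Suc j = i \<or> i = 1 \<and> j = n + 2))"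
    if "x \<in> R4_points n" "y \<in> R4_points n"
    using that by (cases x; cases y) (auto simp: R4_points_def)
  moreover have "Range ?g \<inter> Domain ?g = {}" by auto
  ultimately show ?thesis
    unfolding R4_order_def by (subst generated_order_bipartite) blast+
qed

section \<open>Occurrences of the patterns inside a poset\<close>

locale finite_poset =
  fixes P :: "'a set" and r :: "'a rel"
  assumes finite: "finite P" and order: "partial_order_on P r"
begin

abbreviation le (infix "\<preceq>" 50) where "x \<preceq> y \<equiv> (x, y) \<in> r"
abbreviation lt (infix "\<prec>" 50) where "x \<prec> y \<equiv> x \<preceq> y \<and> x \<noteq> y"
abbreviation inc (infix "\<bowtie>" 50) where "x \<bowtie> y \<equiv> (x, y) \<notin> r \<and> (y, x) \<notin> r"
abbreviation "M \<equiv> max_points P r"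

lemma le_refl: "x \<in> P \<Longrightarrow> x \<preceq> x"
  using order by (auto simp: partial_order_on_def preorder_on_def refl_on_def)

lemma le_trans: "x \<preceq> y \<Longrightarrow> y \<preceq> z \<Longrightarrow> x \<preceq> z"
  using order by (auto simp: partial_order_on_def preorder_on_def dest: transD)

lemma le_antisym: "x \<preceq> y \<Longrightarrow> y \<preceq> x \<Longrightarrow> x = y"
  using order by (auto simp: partial_order_on_def dest: antisymD)

lemma le_in: "x \<preceq> y \<Longrightarrow> x \<in> P" "x \<preceq> y \<Longrightarrow> y \<in> P"
  using order by (auto simp: partial_order_on_def preorder_on_def)

lemma M_in: "z \<in> M \<Longrightarrow> z \<in> P"
  by (simp add: max_points_def)

lemma M_max: "z \<in> M \<Longrightarrow> z \<preceq> y \<Longrightarrow> y = z"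
  using le_in(2) by (auto simp: max_points_def)

text \<open>Distinctness comes for free: incomparable points differ by reflexivity, and none of the
  three is \<open>z\<close>, to which the other two are comparable.\<close>

lemma has_R1_iff:
  "has_peak_subposet P r R1_points R1_order \<longleftrightarrow>
     (\<exists>z\<in>M. \<exists>x y w. x \<preceq> z \<and> y \<preceq> z \<and> w \<preceq> z \<and> x \<bowtie> y \<and> x \<bowtie> w \<and> y \<bowtie> w)"
proof
  assume "has_peak_subposet P r R1_points R1_order"
  then obtain g where "inj_on g R1_points" "g ` R1_points \<subseteq> P"
    and o: "\<And>x y. x \<in> R1_points \<Longrightarrow> y \<in> R1_points \<Longrightarrow> g x \<preceq> g y \<longleftrightarrow> (x, y) \<in> R1_order"
    and m: "\<And>x. x \<in> max_points R1_points R1_order \<Longrightarrow> g x \<in> M"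
    by (rule has_peak_subposetE) (rule that)
  have "Star 1 \<in> max_points R1_points R1_order"
    by (auto simp: max_points_def R1_order_iff R1_points_def)
  from m[OF this] show "\<exists>z\<in>M. \<exists>x y w. x \<preceq> z \<and> y \<preceq> z \<and> w \<preceq> z \<and> x \<bowtie> y \<and> x \<bowtie> w \<and> y \<bowtie> w"
    by (intro bexI[of _ "g (Star 1)"] exI[of _ "g (Pt 1)"] exI[of _ "g (Pt 2)"] exI[of _ "g (Pt 3)"])
       (auto simp: o R1_order_iff R1_points_def)
next
  assume "\<exists>z\<in>M. \<exists>x y w. x \<preceq> z \<and> y \<preceq> z \<and> w \<preceq> z \<and> x \<bowtie> y \<and> x \<bowtie> w \<and> y \<bowtie> w"
  then obtain z x y w where *: "z \<in> M" "x \<preceq> z" "y \<preceq> z" "w \<preceq> z" "x \<bowtie> y" "x \<bowtie> w" "y \<bowtie> w"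
    by blast
  have "x \<noteq> z" "y \<noteq> z" "w \<noteq> z" "x \<noteq> y" "x \<noteq> w" "y \<noteq> w" using * le_refl le_in by metis+
  moreover have "\<not> z \<preceq> x" "\<not> z \<preceq> y" "\<not> z \<preceq> w" using calculation * le_antisym by metis+
  moreover have "z \<in> P" "x \<in> P" "y \<in> P" "w \<in> P" using * le_in by metis+
  moreover have "x \<preceq> x" "y \<preceq> y" "z \<preceq> z" "w \<preceq> w" using calculation le_refl by metis+
  ultimately show "has_peak_subposet P r R1_points R1_order"
    using * by (intro has_peak_subposetI[where
        g = "\<lambda>p. if p = Star 1 then z else if p = Pt 1 then x else if p = Pt 2 then y else w"])
       (auto simp: R1_points_def R1_order_iff inj_on_def max_points_def split: if_splits)
qed

lemma has_R2_iff:
  "has_peak_subposet P r R2_points R2_order \<longleftrightarrow>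
     (\<exists>z\<in>M. \<exists>z'\<in>M. \<exists>x y. z \<noteq> z' \<and> x \<prec> y \<and> y \<preceq> z \<and> y \<preceq> z')"
proof
  assume "has_peak_subposet P r R2_points R2_order"
  then obtain g where i: "inj_on g R2_points" and "g ` R2_points \<subseteq> P"
    and o: "\<And>x y. x \<in> R2_points \<Longrightarrow> y \<in> R2_points \<Longrightarrow> g x \<preceq> g y \<longleftrightarrow> (x, y) \<in> R2_order"
    and m: "\<And>x. x \<in> max_points R2_points R2_order \<Longrightarrow> g x \<in> M"
    by (rule has_peak_subposetE) (rule that)
  have "Star 1 \<in> max_points R2_points R2_order" "Star 2 \<in> max_points R2_points R2_order"
    by (auto simp: max_points_def R2_order_iff R2_points_def)
  moreover have "g (Star 1) \<noteq> g (Star 2)" "g (Pt 1) \<noteq> g (Pt 2)"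
    using i by (auto simp: inj_on_def R2_points_def)
  ultimately show "\<exists>z\<in>M. \<exists>z'\<in>M. \<exists>x y. z \<noteq> z' \<and> x \<prec> y \<and> y \<preceq> z \<and> y \<preceq> z'"
    using m
    by (intro bexI[of _ "g (Star 1)"] bexI[of _ "g (Star 2)"] exI[of _ "g (Pt 1)"] exI[of _ "g (Pt 2)"])
       (auto simp: o R2_order_iff R2_points_def)
next
  assume "\<exists>z\<in>M. \<exists>z'\<in>M. \<exists>x y. z \<noteq> z' \<and> x \<prec> y \<and> y \<preceq> z \<and> y \<preceq> z'"
  then obtain z z' x y where *: "z \<in> M" "z' \<in> M" "z \<noteq> z'" "x \<prec> y" "y \<preceq> z" "y \<preceq> z'"
    by blast
  have "y \<noteq> z" "y \<noteq> z'" using * M_max by metis+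
  moreover have "\<not> z \<preceq> z'" "\<not> z' \<preceq> z" "\<not> y \<preceq> x" "\<not> z \<preceq> y" "\<not> z' \<preceq> y"
    using * calculation M_max le_antisym by metis+
  moreover have "x \<preceq> z" "x \<preceq> z'" using * le_trans by metis+
  moreover have "x \<noteq> z" "x \<noteq> z'" using calculation * by metis+
  moreover have "\<not> z \<preceq> x" "\<not> z' \<preceq> x" using calculation * M_max by metis+
  moreover have "z \<in> P" "x \<in> P" "y \<in> P" "z' \<in> P" using * le_in by metis+
  moreover have "x \<preceq> x" "y \<preceq> y" "z \<preceq> z" "z' \<preceq> z'" using calculation le_refl by metis+
  ultimately show "has_peak_subposet P r R2_points R2_order"
    using * by (intro has_peak_subposetI[where
        g = "\<lambda>p. if p = Star 1 then z else if p = Star 2 then z' else if p = Pt 1 then x else y"])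
       (auto simp: R2_points_def R2_order_iff inj_on_def max_points_def split: if_splits)
qed

lemma has_R3_iff:
  "has_peak_subposet P r R3_points R3_order \<longleftrightarrow>
     (\<exists>u\<in>M. \<exists>v\<in>M. \<exists>w\<in>M. \<exists>x. u \<noteq> v \<and> u \<noteq> w \<and> v \<noteq> w \<and> x \<preceq> u \<and> x \<preceq> v \<and> x \<preceq> w)"
proof
  assume "has_peak_subposet P r R3_points R3_order"
  then obtain g where i: "inj_on g R3_points" and "g ` R3_points \<subseteq> P"
    and o: "\<And>x y. x \<in> R3_points \<Longrightarrow> y \<in> R3_points \<Longrightarrow> g x \<preceq> g y \<longleftrightarrow> (x, y) \<in> R3_order"
    and m: "\<And>x. x \<in> max_points R3_points R3_order \<Longrightarrow> g x \<in> M"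
    by (rule has_peak_subposetE) (rule that)
  have "Star 1 \<in> max_points R3_points R3_order" "Star 2 \<in> max_points R3_points R3_order"
    "Star 3 \<in> max_points R3_points R3_order"
    by (auto simp: max_points_def R3_order_iff R3_points_def)
  moreover have "g (Star 1) \<noteq> g (Star 2)" "g (Star 1) \<noteq> g (Star 3)" "g (Star 2) \<noteq> g (Star 3)"
    using i by (auto simp: inj_on_def R3_points_def)
  ultimately show "\<exists>u\<in>M. \<exists>v\<in>M. \<exists>w\<in>M. \<exists>x. u \<noteq> v \<and> u \<noteq> w \<and> v \<noteq> w \<and> x \<preceq> u \<and> x \<preceq> v \<and> x \<preceq> w"
    using m
    by (intro bexI[of _ "g (Star 1)"] bexI[of _ "g (Star 2)"] bexI[of _ "g (Star 3)"] exI[of _ "g (Pt 1)"])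
       (auto simp: o R3_order_iff R3_points_def)
next
  assume "\<exists>u\<in>M. \<exists>v\<in>M. \<exists>w\<in>M. \<exists>x. u \<noteq> v \<and> u \<noteq> w \<and> v \<noteq> w \<and> x \<preceq> u \<and> x \<preceq> v \<and> x \<preceq> w"
  then obtain u v w x where *: "u \<in> M" "v \<in> M" "w \<in> M" "u \<noteq> v" "u \<noteq> w" "v \<noteq> w"
    "x \<preceq> u" "x \<preceq> v" "x \<preceq> w"
    by blast
  have "x \<noteq> u" "x \<noteq> v" "x \<noteq> w" using * M_max by metis+
  moreover have "\<not> u \<preceq> v" "\<not> u \<preceq> w" "\<not> v \<preceq> u" "\<not> v \<preceq> w" "\<not> w \<preceq> u" "\<not> w \<preceq> v"
    "\<not> u \<preceq> x" "\<not> v \<preceq> x" "\<not> w \<preceq> x"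
    using * calculation M_max by metis+
  moreover have "u \<in> P" "v \<in> P" "w \<in> P" "x \<in> P" using * le_in by metis+
  moreover have "u \<preceq> u" "v \<preceq> v" "w \<preceq> w" "x \<preceq> x" using calculation le_refl by metis+
  ultimately show "has_peak_subposet P r R3_points R3_order"
    using * by (intro has_peak_subposetI[where
        g = "\<lambda>p. if p = Star 1 then u else if p = Star 2 then v else if p = Star 3 then w else x"])
       (auto simp: R3_points_def R3_order_iff inj_on_def max_points_def split: if_splits)
qed

lemma has_R4_iff:
  "has_peak_subposet P r (R4_points n) (R4_order n) \<longleftrightarrow>
     (\<exists>z c. z ` {1..n+2} \<subseteq> M \<and> inj_on z {1..n+2} \<and>
        (\<forall>i\<in>{1..n+2}. \<forall>j\<in>{1..n+2}. i \<noteq> j \<longrightarrow> c i \<bowtie> c j) \<and>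
        (\<forall>i\<in>{1..n+2}. \<forall>j\<in>{1..n+2}. c i \<preceq> z j \<longleftrightarrow> j = i \<or> Suc j = i \<or> i = 1 \<and> j = n + 2))"
    (is "?L \<longleftrightarrow> (\<exists>z c. ?R z c)")
proof
  assume ?L
  then obtain g where i: "inj_on g (R4_points n)" and "g ` (R4_points n) \<subseteq> P"
    and o: "\<And>x y. x \<in> R4_points n \<Longrightarrow> y \<in> R4_points n \<Longrightarrow> g x \<preceq> g y \<longleftrightarrow> (x, y) \<in> R4_order n"
    and m: "\<And>x. x \<in> max_points (R4_points n) (R4_order n) \<Longrightarrow> g x \<in> M"
    by (rule has_peak_subposetE) (rule that)
  have "Star i \<in> max_points (R4_points n) (R4_order n)" if "i \<in> {1..n+2}" for i
    using that by (auto simp: max_points_def R4_order_iff R4_points_def)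
  moreover have "inj_on (\<lambda>k. g (Star k)) {1..n+2}"
    using i by (auto simp: inj_on_def R4_points_def)
  ultimately show "\<exists>z c. ?R z c"
    using m by (intro exI[of _ "\<lambda>k. g (Star k)"] exI[of _ "\<lambda>k. g (Pt k)"])
      (auto simp: o R4_order_iff R4_points_def)
next
  assume "\<exists>z c. ?R z c"
  then obtain z c where R: "?R z c" by (elim exE)
  from R have zM: "z i \<in> M" if "i \<in> {1..n+2}" for i using that by blast
  from R have inj: "inj_on z {1..n+2}" by simp
  from R have cc: "c i \<bowtie> c j" if "i \<in> {1..n+2}" "j \<in> {1..n+2}" "i \<noteq> j" for i j
    using that by blast
  from R have cz: "c i \<preceq> z j \<longleftrightarrow> j = i \<or> Suc j = i \<or> i = 1 \<and> j = n + 2"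
    if "i \<in> {1..n+2}" "j \<in> {1..n+2}" for i j
    using that by blast
  have zz: "z i \<preceq> z j \<longleftrightarrow> i = j" if "i \<in> {1..n+2}" "j \<in> {1..n+2}" for i j
  proof
    assume "z i \<preceq> z j"
    then have "z j = z i" using M_max zM[OF that(1)] by blast
    then show "i = j" using inj_onD[OF inj] that by metis
  next
    assume "i = j"
    then show "z i \<preceq> z j" using le_refl[OF M_in[OF zM[OF that(1)]]] by simp
  qed
  \<comment> \<open>Two different stars above each \<open>c i\<close> are what rules out a star
    below \<open>c i\<close>: such a star would lie below both of them, although stars are pairwise
    incomparable.\<close>
  have two: "\<exists>j\<in>{1..n+2}. \<exists>k\<in>{1..n+2}. j \<noteq> k \<and> c i \<preceq> z j \<and> c i \<preceq> z k" if "i \<in> {1..n+2}" for i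
  proof (cases "i = 1")
    case True
    then show ?thesis using cz[OF that, of 1] cz[OF that, of "n + 2"] that
      by (intro bexI[of _ 1] bexI[of _ "n+2"]) auto
  next
    case False
    then have "i - 1 \<in> {1..n+2}" "Suc (i - 1) = i" "i - 1 \<noteq> i" using that by auto
    then show ?thesis using cz[OF that, of i] cz[OF that, of "i - 1"] that
      by (intro bexI[of _ i] bexI[of _ "i - 1"]) auto
  qed
  have zc: "\<not> z j \<preceq> c i" if ij: "i \<in> {1..n+2}" "j \<in> {1..n+2}" for i j
  proof
    assume a: "z j \<preceq> c i"
    obtain k l where "k \<in> {1..n+2}" "l \<in> {1..n+2}" "k \<noteq> l" "c i \<preceq> z k" "c i \<preceq> z l"
      using two[OF ij(1)] by blast
    then show False using zz[OF ij(2)] le_trans[OF a] by blast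
  qed
  have cP: "c i \<in> P" if "i \<in> {1..n+2}" for i using two[OF that] le_in(1) by blast
  let ?g = "case_point z c"
  show ?L
  proof (rule has_peak_subposetI[where g = ?g])
    show gP: "?g ` R4_points n \<subseteq> P"
      using M_in[OF zM] cP by (auto simp: R4_points_def)
    show ord: "?g x \<preceq> ?g y \<longleftrightarrow> (x, y) \<in> R4_order n" if "x \<in> R4_points n" "y \<in> R4_points n" for x y
    proof (cases x; cases y)
      fix i j assume "x = Pt i" "y = Pt j"
      then show ?thesis using that cc[of i j] cP[of i] le_refl
        by (cases "i = j") (auto simp: R4_points_def R4_order_iff)
    next
      fix i j assume "x = Pt i" "y = Star j"
      then show ?thesis using that cz[of i j] by (auto simp: R4_points_def R4_order_iff)
    next
      fix i j assume "x = Star i" "y = Star j"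
      then show ?thesis using that zz[of i j] by (auto simp: R4_points_def R4_order_iff)
    next
      fix i j assume "x = Star i" "y = Pt j"
      then show ?thesis using that zc[of j i] by (auto simp: R4_points_def R4_order_iff)
    qed
    show "inj_on ?g (R4_points n)"
    proof (rule inj_onI)
      fix x y assume xy: "x \<in> R4_points n" "y \<in> R4_points n" "?g x = ?g y"
      have "?g x \<preceq> ?g x" by (rule le_refl) (use gP xy(1) in blast)
      then have "(x, y) \<in> R4_order n" "(y, x) \<in> R4_order n"
        unfolding ord[OF xy(1,2), symmetric] ord[OF xy(2,1), symmetric] by (simp_all only: xy(3))
      then show "x = y" by (auto simp: R4_order_iff)
    qed
    fix x assume x: "x \<in> max_points (R4_points n) (R4_order n)"
    show "?g x \<in> M"
    proof (cases x)
      case (Star i)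
      then show ?thesis using x zM by (auto simp: max_points_def R4_points_def)
    next
      case (Pt i)
      then have "i \<in> {1..n+2}" using x by (auto simp: max_points_def R4_points_def)
      then have "(x, Star i) \<in> R4_order n" "Star i \<in> R4_points n"
        using Pt by (auto simp: R4_order_iff R4_points_def)
      then show ?thesis using x Pt by (auto simp: max_points_def)
    qed
  qed
qed

end

text \<open>\<open>no_R2\<close> says that shared points are minimal, \<open>no_R3\<close> that a
  point has at most two maximal points above it. The crowns stay folded, as they are used only where
  a second connection produces one.\<close>

locale type_A_poset = finite_poset +
  assumes connected: "connected_poset P r"
    and no_R1: "\<lbrakk>z \<in> M; x \<preceq> z; y \<preceq> z; w \<preceq> z; x \<bowtie> y; x \<bowtie> w; y \<bowtie> w\<rbrakk> \<Longrightarrow> False"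
    and no_R2: "\<lbrakk>z \<in> M; z' \<in> M; z \<noteq> z'; y \<preceq> z; y \<preceq> z'; x \<preceq> y\<rbrakk> \<Longrightarrow> x = y"
    and no_R3: "\<lbrakk>u \<in> M; v \<in> M; w \<in> M; x \<preceq> u; x \<preceq> v; x \<preceq> w\<rbrakk> \<Longrightarrow> u = v \<or> u = w \<or> v = w"
    and no_R4: "\<not> has_peak_subposet P r (R4_points n) (R4_order n)"

lemma poset_type_A_iff: "poset_type_A P r \<longleftrightarrow> type_A_poset P r"
proof (cases "finite_poset P r")
  case True
  then interpret finite_poset P r .
  show ?thesis
  proof
    assume "poset_type_A P r"
    then have *: "connected_poset P r"
      "\<not> has_peak_subposet P r R1_points R1_order" "\<not> has_peak_subposet P r R2_points R2_order"
      "\<not> has_peak_subposet P r R3_points R3_order"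
      "\<And>n. \<not> has_peak_subposet P r (R4_points n) (R4_order n)"
      by (simp_all add: poset_type_A_def)
    show "type_A_poset P r"
    proof unfold_locales
      show "\<lbrakk>z \<in> M; x \<preceq> z; y \<preceq> z; w \<preceq> z; x \<bowtie> y; x \<bowtie> w; y \<bowtie> w\<rbrakk> \<Longrightarrow> False" for z x y w
        using *(2) unfolding has_R1_iff by blast
      show "\<lbrakk>z \<in> M; z' \<in> M; z \<noteq> z'; y \<preceq> z; y \<preceq> z'; x \<preceq> y\<rbrakk> \<Longrightarrow> x = y" for z z' x y
        using *(3) unfolding has_R2_iff by blast
      show "\<lbrakk>u \<in> M; v \<in> M; w \<in> M; x \<preceq> u; x \<preceq> v; x \<preceq> w\<rbrakk> \<Longrightarrow> u = v \<or> u = w \<or> v = w" for u v w x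
        using *(4) unfolding has_R3_iff by blast
    qed (fact *(1) *(5))+
  next
    assume "type_A_poset P r"
    then interpret type_A_poset P r .
    have "\<not> has_peak_subposet P r R1_points R1_order" unfolding has_R1_iff using no_R1 by blast
    moreover have "\<not> has_peak_subposet P r R2_points R2_order"
      unfolding has_R2_iff using no_R2 by blast
    moreover have "\<not> has_peak_subposet P r R3_points R3_order"
      unfolding has_R3_iff using no_R3 by blast
    ultimately show "poset_type_A P r"
      using finite order connected no_R4 by (simp add: poset_type_A_def)
  qed
next
  case False
  then show ?thesis
    unfolding poset_type_A_def type_A_poset_def finite_poset_def by blast
qed

section \<open>Posets of width two\<close>

context finite_poset
begin

lemma ex_maximal:
  assumes "x \<in> X" "X \<subseteq> P"
  obtains m where "m \<in> X" "x \<preceq> m" "\<And>y. y \<in> X \<Longrightarrow> m \<preceq> y \<Longrightarrow> y = m"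
proof -
  have "r \<subseteq> P \<times> P" using le_in by auto
  then have "finite (r\<inverse>)" using finite finite_subset by fastforce
  then have "wf (r\<inverse> - Id)"
    using order by (intro partial_order_on_well_order_on[of _ P]) auto
  moreover have "x \<in> {y \<in> X. x \<preceq> y}" using assms le_refl by auto
  ultimately obtain m where "m \<in> {y \<in> X. x \<preceq> y}"
    "\<And>y. (y, m) \<in> r\<inverse> - Id \<Longrightarrow> y \<notin> {y \<in> X. x \<preceq> y}"
    by (rule wfE_min) blast
  then show thesis using that le_trans by blast
qed

lemma ChainsD: "C \<in> Chains r \<Longrightarrow> x \<in> C \<Longrightarrow> y \<in> C \<Longrightarrow> x \<preceq> y \<or> y \<preceq> x"
  by (simp add: Chains_def)

lemma ex_greatest:
  assumes "C \<in> Chains r" "X \<subseteq> C" "X \<subseteq> P" "X \<noteq> {}"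
  obtains m where "m \<in> X" "\<And>y. y \<in> X \<Longrightarrow> y \<preceq> m"
proof -
  obtain x where "x \<in> X" using assms by blast
  then obtain m where m: "m \<in> X" "\<And>y. y \<in> X \<Longrightarrow> m \<preceq> y \<Longrightarrow> y = m"
    using ex_maximal assms(3) by metis
  show thesis
  proof
    fix y assume y: "y \<in> X"
    then have "y \<preceq> m \<or> m \<preceq> y" using m(1) assms(1,2) by (auto dest: ChainsD)
    then show "y \<preceq> m" using m(2)[OF y] le_refl assms(3) y by auto
  qed (fact m(1))
qed

text \<open>Dilworth's theorem for width two, by Galvin's argument.\<close>

lemma width_two_partition:
  assumes "X \<subseteq> P"
    and "\<And>x y w. \<lbrakk>x \<in> X; y \<in> X; w \<in> X; x \<bowtie> y; x \<bowtie> w; y \<bowtie> w\<rbrakk> \<Longrightarrow> False"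
  shows "\<exists>A B. A \<union> B = X \<and> A \<inter> B = {} \<and> A \<in> Chains r \<and> B \<in> Chains r"
proof -
  have "finite X" using assms(1) finite finite_subset by blast
  then show ?thesis using assms
  proof (induction X rule: finite_psubset_induct)
    case (psubset X)
    show ?case
    proof (cases "X = {}")
      case True
      then show ?thesis by (auto simp: Chains_def)
    next
      case False
      then obtain m where m: "m \<in> X" "\<And>y. y \<in> X \<Longrightarrow> m \<preceq> y \<Longrightarrow> y = m"
        using ex_maximal psubset.prems(1) by (metis all_not_in_conv)
      let ?X = "X - {m}"
      have "\<exists>A B. A \<union> B = ?X \<and> A \<inter> B = {} \<and> A \<in> Chains r \<and> B \<in> Chains r"
      proof (rule psubset.IH)
        show "?X \<subset> X" "?X \<subseteq> P" using m(1) psubset.prems(1) by auto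
        show "\<And>x y w. \<lbrakk>x \<in> ?X; y \<in> ?X; w \<in> ?X; x \<bowtie> y; x \<bowtie> w; y \<bowtie> w\<rbrakk> \<Longrightarrow> False"
          using psubset.prems(2) by blast
      qed
      then obtain A B where AB: "A \<union> B = ?X" "A \<inter> B = {}" "A \<in> Chains r" "B \<in> Chains r" by blast
      have mm: "m \<preceq> m" using m(1) psubset.prems(1) le_refl by auto
      \<comment> \<open>Galvin's step: \<open>a\<close> bounds the points of \<open>C\<close> that
        are incomparable to something in \<open>E\<close>. The part of \<open>C\<close> below
        \<open>a\<close>, topped by \<open>m\<close>, is a chain; the rest of \<open>C\<close> is
        comparable to all of \<open>E\<close> and can be merged with it.\<close>
      have split: ?thesis
        if C: "C \<union> E = ?X" "C \<inter> E = {}" "C \<in> Chains r" "E \<in> Chains r"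
          and a: "\<And>x. x \<in> C \<Longrightarrow> \<exists>y\<in>E. x \<bowtie> y \<Longrightarrow> x \<preceq> a" "a \<preceq> m" for C E a
      proof (intro exI conjI)
        let ?K = "insert m {x \<in> C. x \<preceq> a}"
        show "?K \<union> (X - ?K) = X" "?K \<inter> (X - ?K) = {}" using C(1) m(1) by auto
        have "x \<preceq> m" if "x \<in> ?K" for x using that le_trans a(2) mm by blast
        then show "?K \<in> Chains r" using C(3) unfolding Chains_def by blast
        have "x \<in> E \<or> x \<in> C \<and> \<not> x \<preceq> a" if "x \<in> X - ?K" for x using that C(1) by auto
        note 1 = this
        have 2: "x \<preceq> y \<or> y \<preceq> x" if "x \<in> C" "\<not> x \<preceq> a" "y \<in> E" for x y
          using that a(1) by blast
        have "x \<preceq> y \<or> y \<preceq> x" if "x \<in> X - ?K" "y \<in> X - ?K" for x y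
          using 1[OF that(1)] 1[OF that(2)] 2[of x y] 2[of y x]
            ChainsD[OF C(3), of x y] ChainsD[OF C(4), of x y] by blast
        then show "X - ?K \<in> Chains r" unfolding Chains_def by simp
      qed
      show ?thesis
      proof (cases "\<exists>x\<in>A. \<exists>y\<in>B. x \<bowtie> y")
        case False
        then have "?X \<in> Chains r" using AB unfolding Chains_def by blast
        moreover have "{m} \<in> Chains r" using mm by (simp add: Chains_def)
        moreover have "{m} \<union> ?X = X" "{m} \<inter> ?X = {}" using m(1) by auto
        ultimately show ?thesis by blast
      next
        case True
        have sub: "A \<subseteq> P" "B \<subseteq> P" using AB(1) psubset.prems(1) by auto
        obtain a where a: "a \<in> {x \<in> A. \<exists>y\<in>B. x \<bowtie> y}"
          "\<And>x. x \<in> {x \<in> A. \<exists>y\<in>B. x \<bowtie> y} \<Longrightarrow> x \<preceq> a"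
          by (rule ex_greatest[OF AB(3), of "{x \<in> A. \<exists>y\<in>B. x \<bowtie> y}"]) (use True sub in auto)
        obtain b where b: "b \<in> {y \<in> B. \<exists>x\<in>A. y \<bowtie> x}"
          "\<And>y. y \<in> {y \<in> B. \<exists>x\<in>A. y \<bowtie> x} \<Longrightarrow> y \<preceq> b"
          by (rule ex_greatest[OF AB(4), of "{y \<in> B. \<exists>x\<in>A. y \<bowtie> x}"]) (use True sub in auto)
        \<comment> \<open>The partner of \<open>b\<close> in \<open>A\<close> lies below
          \<open>a\<close>, so \<open>a \<preceq> b\<close> would make it comparable to
          \<open>b\<close>. The next line is symmetric.\<close>
        have "\<not> a \<preceq> b" using b(1) a(2) le_trans by blast
        moreover have "\<not> b \<preceq> a" using a(1) b(2) le_trans by blast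
        moreover have "a \<in> ?X" "b \<in> ?X" using a(1) b(1) AB(1) by auto
        \<comment> \<open>Otherwise \<open>a\<close>, \<open>b\<close>, \<open>m\<close> would be an
          antichain, since the maximal \<open>m\<close> is below neither of the others.\<close>
        ultimately have "a \<preceq> m \<or> b \<preceq> m"
          using m psubset.prems(2)[of a b m] by auto
        then show ?thesis
        proof
          assume "a \<preceq> m"
          then show ?thesis using split[OF AB] a(2) by blast
        next
          assume "b \<preceq> m"
          moreover have "B \<union> A = ?X" "B \<inter> A = {}" using AB by auto
          moreover have "x \<preceq> b" if "x \<in> B" "\<exists>y\<in>A. x \<bowtie> y" for x using b(2) that by blast
          ultimately show ?thesis using split[OF _ _ AB(4) AB(3)] by metis
        qed
      qed
    qed
  qed
qed

text \<open>Incomparable points cannot share a chain, so any partition separates \<open>C\<close>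
  from \<open>E\<close> after exchanging the two chains if necessary. Sets with at most one element
  are used instead of points because the first and the last block lack a shared point on one
  side.\<close>

lemma width_two_partition_split:
  assumes "X \<subseteq> P"
    and "\<And>x y w. \<lbrakk>x \<in> X; y \<in> X; w \<in> X; x \<bowtie> y; x \<bowtie> w; y \<bowtie> w\<rbrakk> \<Longrightarrow> False"
    and C: "C \<subseteq> X" "\<And>x y. x \<in> C \<Longrightarrow> y \<in> C \<Longrightarrow> x = y"
    and E: "E \<subseteq> X" "\<And>x y. x \<in> E \<Longrightarrow> y \<in> E \<Longrightarrow> x = y"
    and CE: "\<And>x y. x \<in> C \<Longrightarrow> y \<in> E \<Longrightarrow> x \<bowtie> y"
  shows "\<exists>A B. A \<union> B = X \<and> A \<inter> B = {} \<and> A \<in> Chains r \<and> B \<in> Chains r \<and> C \<subseteq> A \<and> E \<subseteq> B"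
proof -
  have "\<exists>A B. A \<union> B = X \<and> A \<inter> B = {} \<and> A \<in> Chains r \<and> B \<in> Chains r"
    by (rule width_two_partition) (fact assms(1), fact assms(2))
  then obtain A B where AB: "A \<union> B = X" "A \<inter> B = {}" "A \<in> Chains r" "B \<in> Chains r"
    by (elim exE conjE)
  have "C \<subseteq> A \<and> E \<subseteq> B \<or> C \<subseteq> B \<and> E \<subseteq> A"
  proof (cases "C = {}")
    case True
    then show ?thesis using AB(1) E by blast
  next
    case False
    then have "C \<subseteq> A \<or> C \<subseteq> B" using AB(1) C by blast
    then show ?thesis
    proof
      assume "C \<subseteq> A"
      then have "E \<inter> A = {}" using False CE AB(3) by (auto dest: ChainsD)
      then show ?thesis using \<open>C \<subseteq> A\<close> AB(1) E(1) by blast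
    next
      assume "C \<subseteq> B"
      then have "E \<inter> B = {}" using False CE AB(4) by (auto dest: ChainsD)
      then show ?thesis using \<open>C \<subseteq> B\<close> AB(1) E(1) by blast
    qed
  qed
  then show ?thesis using AB by (metis Int_commute Un_commute)
qed

lemma Chains_sorted:
  assumes "C \<in> Chains r" "C \<subseteq> P"
  shows "\<exists>xs. set xs = C \<and> sorted_wrt (\<prec>) xs"
proof -
  have "finite C" using assms(2) finite finite_subset by blast
  then show ?thesis using assms
  proof (induction C rule: finite_psubset_induct)
    case (psubset C)
    show ?case
    proof (cases "C = {}")
      case False
      then obtain m where m: "m \<in> C" "\<And>y. y \<in> C \<Longrightarrow> y \<preceq> m"
        using ex_greatest[OF psubset.prems(1) order_refl psubset.prems(2)] by metis
      have "C - {m} \<in> Chains r" using psubset.prems(1) by (auto simp: Chains_def)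
      then obtain xs where xs: "set xs = C - {m}" "sorted_wrt (\<prec>) xs"
        using psubset.IH[of "C - {m}"] m(1) psubset.prems(2) by auto
      then show ?thesis
        using m by (intro exI[of _ "xs @ [m]"]) (auto simp: sorted_wrt_append)
    qed auto
  qed
qed

lemma sorted_distinct: "sorted_wrt (\<prec>) xs \<Longrightarrow> distinct xs"
  by (induction xs) auto

section \<open>Lists climbing to a maximal point and descending again\<close>

abbreviation D where "D z \<equiv> {x. x \<preceq> z}"

abbreviation comparable where "comparable x y \<equiv> x \<preceq> y \<or> y \<preceq> x"

text \<open>The lists \<open>us\<close> and \<open>ws\<close> are arbitrary, so that the property
  survives when the path is prolonged. Neighbouring blocks are allowed to overlap, as they do in
  their shared point.\<close>

definition block :: "'a list \<Rightarrow> 'a \<Rightarrow> bool" where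
  "block vs z \<longleftrightarrow> (\<exists>us ls rs ws. vs = us @ ls @ z # rs @ ws \<and> set (ls @ z # rs) = D z \<and>
     sorted_wrt (\<prec>) ls \<and> sorted_wrt (\<prec>) (rev rs))"

lemma block_append: "block vs z \<Longrightarrow> block (vs @ xs) z"
  unfolding block_def
proof (elim exE conjE, intro exI conjI)
  fix us ls rs ws assume "vs = us @ ls @ z # rs @ ws"
  then show "vs @ xs = us @ ls @ z # rs @ (ws @ xs)" by simp
qed

text \<open>\<open>C\<close> and \<open>E\<close> hold the points to be shared with the blocks on
  the left and on the right. Being minimal, these are incomparable to each other and the bottoms of
  their chains, which puts them at the outer ends of the list.\<close>

lemma down_set_list:
  assumes z: "z \<in> M"
    and no_R1: "\<And>x y w. \<lbrakk>x \<preceq> z; y \<preceq> z; w \<preceq> z; x \<bowtie> y; x \<bowtie> w; y \<bowtie> w\<rbrakk> \<Longrightarrow> False"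
    and C: "C \<subseteq> D z - {z}" "\<And>x y. x \<in> C \<Longrightarrow> y \<in> C \<Longrightarrow> x = y" "\<And>x y. x \<in> C \<Longrightarrow> y \<preceq> x \<Longrightarrow> y = x"
    and E: "E \<subseteq> D z - {z}" "\<And>x y. x \<in> E \<Longrightarrow> y \<in> E \<Longrightarrow> x = y" "\<And>x y. x \<in> E \<Longrightarrow> y \<preceq> x \<Longrightarrow> y = x"
    and CE: "C \<inter> E = {}"
  obtains ls rs where "set (ls @ z # rs) = D z" "distinct (ls @ z # rs)"
    "sorted_wrt (\<prec>) ls" "sorted_wrt (\<prec>) (rev rs)" "successively comparable (ls @ z # rs)"
    "\<And>x. x \<in> C \<Longrightarrow> ls \<noteq> [] \<and> hd ls = x" "\<And>x. x \<in> E \<Longrightarrow> rs \<noteq> [] \<and> last rs = x"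
proof -
  have "\<exists>A B. A \<union> B = D z - {z} \<and> A \<inter> B = {} \<and> A \<in> Chains r \<and> B \<in> Chains r \<and> C \<subseteq> A \<and> E \<subseteq> B"
  proof (rule width_two_partition_split)
    show "D z - {z} \<subseteq> P" using le_in by auto
    show "\<And>x y. x \<in> C \<Longrightarrow> y \<in> E \<Longrightarrow> x \<bowtie> y" using CE C(3) E(3) by blast
    show "\<And>x y w. \<lbrakk>x \<in> D z - {z}; y \<in> D z - {z}; w \<in> D z - {z}; x \<bowtie> y; x \<bowtie> w; y \<bowtie> w\<rbrakk> \<Longrightarrow> False"
      using no_R1 by blast
  qed (use C E in auto)
  then obtain A B where AB: "A \<union> B = D z - {z}" "A \<inter> B = {}" "A \<in> Chains r" "B \<in> Chains r"
    "C \<subseteq> A" "E \<subseteq> B" by blast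
  have "A \<subseteq> P" "B \<subseteq> P" using AB(1) le_in by auto
  then obtain ls ss where ls: "set ls = A" "sorted_wrt (\<prec>) ls" and ss: "set ss = B" "sorted_wrt (\<prec>) ss"
    using Chains_sorted[OF AB(3)] Chains_sorted[OF AB(4)] by blast
  \<comment> \<open>A minimal element of a chain comes first when the chain is sorted
    upwards.\<close>
  have hd: "xs \<noteq> [] \<and> hd xs = x"
    if "x \<in> set xs" "\<And>y. y \<preceq> x \<Longrightarrow> y = x" "sorted_wrt (\<prec>) xs" for x xs
    using that by (cases xs) auto
  have "successively (\<prec>) (ls @ [z])" "successively (\<prec>) (ss @ [z])"
    by (rule successively_if_sorted_wrt;
        use ls ss AB(1) in \<open>auto simp: sorted_wrt_append\<close>)+
  then have "successively comparable (ls @ [z])" "successively (\<lambda>x y. comparable y x) (ss @ [z])"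
    by (auto elim!: successively_mono)
  then have suc: "successively comparable (ls @ [z])" "successively comparable (z # rev ss)"
    using successively_rev[of comparable "ss @ [z]"] by auto
  show thesis
  proof (rule that[of ls "rev ss"])
    show "set (ls @ z # rev ss) = D z" using ls ss AB(1) z le_refl M_in by auto
    show "distinct (ls @ z # rev ss)"
      using ls ss AB(1,2) sorted_distinct by auto
    show "successively comparable (ls @ z # rev ss)"
      using suc by (auto simp: successively_append_iff)
    show "\<And>x. x \<in> C \<Longrightarrow> ls \<noteq> [] \<and> hd ls = x" using hd[OF _ _ ls(2)] C(3) AB(5) ls(1) by blast
    show "\<And>x. x \<in> E \<Longrightarrow> rev ss \<noteq> [] \<and> last (rev ss) = x"
      using hd[OF _ _ ss(2)] E(3) AB(6) ss(1) by (metis rev_is_Nil_conv last_rev subsetD)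
  qed (use ls ss in auto)
qed

end

section \<open>Arranging a poset of type A along a path\<close>

context type_A_poset
begin

text \<open>Induction on the number \<open>k\<close> of blocks laid out. While another block is to
  follow, the list has to end in \<open>c (k - 1)\<close>, the point on which that block is
  glued.\<close>

lemma arrange_down_sets:
  fixes z c :: "nat \<Rightarrow> 'a" and m :: nat
  assumes zM: "\<And>i. i < m \<Longrightarrow> z i \<in> M" and inj: "inj_on z {..<m}"
    and c: "\<And>i. Suc i < m \<Longrightarrow> c i \<preceq> z i \<and> c i \<preceq> z (Suc i)"
    and uniq: "\<And>i j x. \<lbrakk>i < j; j < m; x \<preceq> z i; x \<preceq> z j\<rbrakk> \<Longrightarrow> j = Suc i \<and> x = c i"
    and "k \<le> m"
  shows "\<exists>vs. distinct vs \<and> set vs = (\<Union>i<k. D (z i)) \<and> successively comparable vs \<and>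
     (0 < k \<and> k < m \<longrightarrow> vs \<noteq> [] \<and> last vs = c (k - 1)) \<and> (\<forall>i<k. block vs (z i))"
  using \<open>k \<le> m\<close>
proof (induction k)
  case 0
  show ?case by (intro exI[of _ "[]"]) simp
next
  case (Suc k)
  then have k: "k < m" by simp
  obtain vs where vs: "distinct vs" "set vs = (\<Union>i<k. D (z i))" "successively comparable vs"
    "0 < k \<Longrightarrow> vs \<noteq> [] \<and> last vs = c (k - 1)" "\<And>i. i < k \<Longrightarrow> block vs (z i)"
    using Suc.IH k by auto
  have zz: "z i \<noteq> z j" if "i < m" "j < m" "i \<noteq> j" for i j
    using inj that by (auto simp: inj_on_def)
  have cmin: "y = c i" if "Suc i < m" "y \<preceq> c i" for i y
    using no_R2[of "z i" "z (Suc i)" "c i" y] zM zz[of i "Suc i"] c that by auto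
  have cz: "c i \<noteq> z j" if "Suc i < m" "j < m" for i j
  proof
    assume "c i = z j"
    then have "z j = z i" "z j = z (Suc i)"
      using M_max[OF zM[OF that(2)]] c[OF that(1)] by metis+
    then show False using zz[of i "Suc i"] that by simp
  qed
  \<comment> \<open>The first block has no shared point on its left and the last one none on its
    right.\<close>
  define C where "C = (if k = 0 then {} else {c (k - 1)})"
  define E where "E = (if Suc k < m then {c k} else {})"
  \<comment> \<open>If both were the same point, it would lie below \<open>z (k - 1)\<close> and
    \<open>z (Suc k)\<close>, which are not neighbours.\<close>
  have CE: "C \<inter> E = {}"
  proof -
    have False if "0 < k" "Suc k < m" "c (k - 1) = c k"
    proof -
      have "k - 1 < Suc k" "Suc k \<noteq> Suc (k - 1)" "Suc (k - 1) < m" "Suc (k - 1) = k"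
        using that by auto
      then show False
        using uniq[of "k - 1" "Suc k" "c k"] c[of "k - 1"] c[of k] that by simp
    qed
    then show ?thesis by (auto simp: C_def E_def split: if_splits)
  qed
  obtain ls rs where l: "set (ls @ z k # rs) = D (z k)" "distinct (ls @ z k # rs)"
    "sorted_wrt (\<prec>) ls" "sorted_wrt (\<prec>) (rev rs)" "successively comparable (ls @ z k # rs)"
    "\<And>x. x \<in> C \<Longrightarrow> ls \<noteq> [] \<and> hd ls = x" "\<And>x. x \<in> E \<Longrightarrow> rs \<noteq> [] \<and> last rs = x"
  proof (rule down_set_list[OF zM[OF k]])
    show "C \<subseteq> D (z k) - {z k}" using c[of "k - 1"] cz[of "k - 1" k] k by (auto simp: C_def)
    show "E \<subseteq> D (z k) - {z k}" using c[of k] cz[of k k] by (auto simp: E_def)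
    show "y = x" if "x \<in> C" "y \<preceq> x" for x y
      using cmin[of "k - 1"] that k by (auto simp: C_def split: if_splits)
    show "y = x" if "x \<in> E" "y \<preceq> x" for x y
      using cmin[of k] that by (auto simp: E_def split: if_splits)
    show "C \<inter> E = {}" by (fact CE)
    show "False" if "x \<preceq> z k" "y \<preceq> z k" "w \<preceq> z k" "x \<bowtie> y" "x \<bowtie> w" "y \<bowtie> w" for x y w
      using no_R1[OF zM[OF k] that] .
  qed (auto simp: C_def E_def split: if_splits)
  have last: "Suc k < m \<longrightarrow> rs \<noteq> [] \<and> last (xs @ z k # rs) = c k" for xs
    using l(7) by (auto simp: E_def)
  show ?case
  proof (cases "k = 0")
    case True
    have "block (ls @ z k # rs) (z k)"
      unfolding block_def 
      by (rule exI[of _ "[]"], rule exI[of _ ls], rule exI[of _ rs], rule exI[of _ "[]"])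
        (use l in simp)
    then show ?thesis
      using True l last[of ls] by (intro exI[of _ "ls @ z k # rs"]) auto
  next
    case False
    define ls' where "ls' = tl ls"
    have ls: "ls = c (k - 1) # ls'"
      using l(6)[of "c (k - 1)"] False by (cases ls) (auto simp: C_def ls'_def)
    have vs': "vs \<noteq> []" "vs = butlast vs @ [c (k - 1)]"
      using vs(4) False append_butlast_last_id by (metis neq0_conv)+
    \<comment> \<open>The head of \<open>ls\<close> is dropped, because it is already the last point
      of \<open>vs\<close>.\<close>
    let ?vs = "vs @ ls' @ z k # rs"
    have eq: "?vs = butlast vs @ ls @ z k # rs" using vs'(2) ls by (metis append.assoc append_Cons append_Nil)
    \<comment> \<open>By \<open>uniq\<close>, a point of an earlier block that is also below
      \<open>z k\<close> can only be the gluing point.\<close>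
    have disj: "x = c (k - 1)" if "x \<in> set vs" "x \<preceq> z k" for x
      using vs(2) uniq[of _ k x] k that by fastforce
    have "distinct ?vs"
    proof -
      have "set (ls' @ z k # rs) \<subseteq> D (z k)" using l(1) ls by auto
      moreover have "c (k - 1) \<notin> set (ls' @ z k # rs)" using l(2) ls by auto
      ultimately have "set vs \<inter> set (ls' @ z k # rs) = {}" using disj by blast
      moreover have "distinct (ls' @ z k # rs)" using l(2) ls by auto
      ultimately show ?thesis using vs(1) distinct_append by blast
    qed
    moreover have "set ?vs = (\<Union>i<Suc k. D (z i))"
    proof -
      have "c (k - 1) \<in> set vs" using vs' by (metis last_in_set last_snoc)
      then have "set ?vs = set vs \<union> set (ls @ z k # rs)" using ls by auto
      then show ?thesis unfolding l(1) vs(2) lessThan_Suc by auto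
    qed
    moreover have "successively comparable ?vs"
    proof -
      have "successively comparable ((c (k - 1) # ls') @ z k # rs)" using l(5) ls by simp
      then show ?thesis
        using vs(3,4) False vs'(1) by (auto simp: successively_append_iff successively_Cons)
    qed
    moreover have "block ?vs (z i)" if "i < Suc k" for i
    proof (cases "i = k")
      case True
      have "block (butlast vs @ ls @ z k # rs) (z k)"
        unfolding block_def
        by (rule exI[of _ "butlast vs"], rule exI[of _ ls], rule exI[of _ rs], rule exI[of _ "[]"])
          (use l in simp)
      then show ?thesis unfolding eq True .
    next
      case False
      then show ?thesis using block_append vs(5) that by simp
    qed
    ultimately show ?thesis
      using last[of "vs @ ls'"] by (intro exI[of _ ?vs]) auto
  qed
qed

abbreviation joined where "joined z z' \<equiv> z \<in> M \<and> z' \<in> M \<and> z \<noteq> z' \<and> (\<exists>x. x \<preceq> z \<and> x \<preceq> z')"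

lemma ex_max_above:
  assumes "x \<in> P"
  obtains z where "z \<in> M" "x \<preceq> z"
  by (rule ex_maximal[OF assms order_refl]) (use that in \<open>auto simp: max_points_def\<close>)

text \<open>A longest path in the graph of maximal points with common lower bounds: a further
  neighbour of an inner vertex would give a copy of the first excluded poset.\<close>

lemma max_points_path:
  obtains zs where "set zs = M" "distinct zs" "successively joined zs"
proof -
  let ?good = "\<lambda>zs. zs \<noteq> [] \<and> set zs \<subseteq> M \<and> distinct zs \<and> successively joined zs"
  obtain x0 where "x0 \<in> P" using connected by (auto simp: connected_poset_def)
  then obtain z0 where "z0 \<in> M" using ex_max_above by blast
  have finM: "finite M" using finite by (simp add: max_points_def)
  have "?good [z0]" using \<open>z0 \<in> M\<close> by simp
  moreover have "\<forall>zs. ?good zs \<longrightarrow> length zs < Suc (card M)"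
    using finM by (metis card_mono distinct_card less_Suc_eq_le)
  ultimately obtain zs where good: "?good zs" and longest: "\<And>zs'. ?good zs' \<Longrightarrow> length zs' \<le> length zs"
    using ex_has_greatest_nat[of ?good "[z0]" length "Suc (card M)"] by auto
  have closed: "w \<in> set zs" if v: "v \<in> set zs" and vw: "joined v w" for v w
  proof (rule ccontr)
    assume w: "w \<notin> set zs"
    obtain i where i: "i < length zs" "v = zs ! i" using v by (auto simp: in_set_conv_nth)
    have step: "joined (zs ! j) (zs ! Suc j)" if "Suc j < length zs" for j
      using good that by (auto simp: successively_conv_nth)
    \<comment> \<open>If \<open>v\<close> were an end of the path, then \<open>w\<close> would
      prolong it beyond the maximal length.\<close>
    have ends: "i \<noteq> 0" "Suc i \<noteq> length zs"
    proof -
      show "i \<noteq> 0"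
      proof
        assume "i = 0"
        then have "?good (w # zs)"
          using good w vw i by (auto simp: successively_Cons hd_conv_nth)
        then show False using longest[of "w # zs"] by simp
      qed
      show "Suc i \<noteq> length zs"
      proof
        assume "Suc i = length zs"
        then have "last zs = v" using i good by (metis diff_Suc_1 last_conv_nth)
        then have "?good (zs @ [w])"
          using good w vw by (auto simp: successively_append_iff)
        then show False using longest[of "zs @ [w]"] by simp
      qed
    qed
    define u u' where "u = zs ! (i - 1)" and "u' = zs ! Suc i"
    have l: "Suc i < length zs" using ends i by simp
    have uv: "joined u v" using step[of "i - 1"] ends i by (simp add: u_def)
    have vu': "joined v u'" using step[of i] l i by (simp add: u'_def)
    have "u \<noteq> u'" using good l by (auto simp: u_def u'_def nth_eq_iff_index_eq)
    moreover have "u \<noteq> w" "u' \<noteq> w" using w l by (auto simp: u_def u'_def)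
    ultimately have dist: "u \<noteq> u'" "u \<noteq> w" "u' \<noteq> w" "v \<noteq> u" "v \<noteq> u'" "v \<noteq> w"
      using uv vu' vw by auto
    have M: "u \<in> M" "u' \<in> M" "v \<in> M" "w \<in> M" using uv vu' vw by auto
    obtain a b c where abc: "a \<preceq> v" "a \<preceq> u" "b \<preceq> v" "b \<preceq> u'" "c \<preceq> v" "c \<preceq> w"
      using uv vu' vw by blast
    \<comment> \<open>A coincidence would give a point below three maximal points. Each of the three
      is shared, hence minimal, so being different they form an antichain below
      \<open>v\<close>.\<close>
    have "a \<noteq> b" "a \<noteq> c" "b \<noteq> c" using no_R3 M abc dist by metis+
    moreover have "y = a" if "y \<preceq> a" for y using no_R2[of v u a y] M abc dist that by simp
    moreover have "y = b" if "y \<preceq> b" for y using no_R2[of v u' b y] M abc dist that by simp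
    moreover have "y = c" if "y \<preceq> c" for y using no_R2[of v w c y] M abc dist that by simp
    ultimately have "a \<bowtie> b" "a \<bowtie> c" "b \<bowtie> c" by metis+
    then show False using no_R1[OF \<open>v \<in> M\<close>] abc by blast
  qed
  have "M \<subseteq> set zs"
  proof
    fix w assume "w \<in> M"
    define x where "x = hd zs"
    have x: "x \<in> set zs" "x \<in> M" using good by (auto simp: x_def)
    have "(x, w) \<in> (Restr (r \<union> r\<inverse>) P)\<^sup>*"
      using connected x(2) \<open>w \<in> M\<close> M_in by (simp add: connected_poset_def)
    \<comment> \<open>Induction along a zigzag starting in \<open>x\<close>, with the claim for all
      maximal points above the point reached. Only a downward step matters: the lower point joins
      any maximal point above it to one that is already in \<open>zs\<close>.\<close>
    then have "\<forall>v\<in>M. w \<preceq> v \<longrightarrow> v \<in> set zs"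
    proof (induction rule: rtrancl_induct)
      case base
      show ?case using M_max x by blast
    next
      case (step y y')
      show ?case
      proof (intro ballI impI)
        fix v assume v: "v \<in> M" "y' \<preceq> v"
        consider "y \<preceq> y'" | "y' \<preceq> y" "y \<in> P" using step.hyps(2) by blast
        then show "v \<in> set zs"
        proof cases
          case 1
          then show ?thesis using step.IH v le_trans by blast
        next
          case 2
          obtain u where u: "u \<in> M" "y \<preceq> u" using 2(2) ex_max_above by blast
          then have "u \<in> set zs" using step.IH by blast
          moreover have "y' \<preceq> u" using 2(1) u(2) le_trans by blast
          ultimately show ?thesis using closed[of u v] u(1) v by metis
        qed
      qed
    qed
    then show "w \<in> set zs" using \<open>w \<in> M\<close> M_in le_refl by blast
  qed
  then show thesis using that good by blast
qed

text \<open>A second connection between two points of the path closes a crown.\<close>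

lemma no_crown:
  fixes z c :: "nat \<Rightarrow> 'a" and m :: nat
  assumes zM: "\<And>i. i < m \<Longrightarrow> z i \<in> M" and inj: "inj_on z {..<m}"
    and c: "\<And>i. Suc i < m \<Longrightarrow> c i \<preceq> z i \<and> c i \<preceq> z (Suc i)"
    and "i < j" "j < m" and x: "x \<preceq> z i" "x \<preceq> z j"
  shows "j = Suc i \<and> x = c i"
proof (rule ccontr)
  assume neg: "\<not> (j = Suc i \<and> x = c i)"
  have zz: "z i = z j \<longleftrightarrow> i = j" if "i < m" "j < m" for i j
    using inj that by (auto simp: inj_on_def)
  have below_c: "k = l \<or> k = Suc l" if "k < m" "Suc l < m" "c l \<preceq> z k" for k l
    using no_R3[of "z k" "z l" "z (Suc l)" "c l"] zM c zz that by auto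
  have below_x: "k = i \<or> k = j" if "k < m" "x \<preceq> z k" for k
    using no_R3[of "z k" "z i" "z j" x] zM x zz that \<open>i < j\<close> \<open>j < m\<close> by auto
  have cmin: "y = c l" if "Suc l < m" "y \<preceq> c l" for l y
    using no_R2[of "z l" "z (Suc l)" "c l" y] zM zz c that by auto
  have xmin: "y = x" if "y \<preceq> x" for y
    using no_R2[of "z i" "z j" x y] zM zz x that \<open>i < j\<close> \<open>j < m\<close> by auto
  have cc: "c k \<noteq> c l" if "Suc k < m" "Suc l < m" "k \<noteq> l" for k l
  proof
    assume "c k = c l"
    then have "c k \<preceq> z l" "c k \<preceq> z (Suc l)" using c[OF that(2)] by auto
    then show False using below_c[of l k] below_c[of "Suc l" k] that by auto
  qed
  \<comment> \<open>Equality would put both \<open>l\<close> and \<open>Suc l\<close> into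
    \<open>{i, j}\<close>, hence \<open>l = i\<close> and \<open>j = Suc i\<close>, which is the
    case excluded by \<open>neg\<close>.\<close>
  have cx: "x \<noteq> c l" if "Suc l < m" for l
  proof
    assume "x = c l"
    then have "l = i \<or> l = j" "Suc l = i \<or> Suc l = j" "i = l \<or> i = Suc l"
      using below_x[of l] below_x[of "Suc l"] below_c[of i l] c[OF that] that x by auto
    then show False using neg \<open>x = c l\<close> \<open>i < j\<close> by auto
  qed
  \<comment> \<open>The crown has the \<open>n + 2\<close> stars \<open>z i, ..., z j\<close>;
    consecutive ones are linked by the given \<open>c\<close>, and \<open>x\<close> closes the cycle
    as point number \<open>1\<close>. For \<open>j = Suc i\<close> this is a double edge, with
    \<open>n = 0\<close>.\<close>
  define n where "n = j - i - 1"
  define z' where "z' k = z (i + k - 1)" for k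
  define c' where "c' k = (if k = 1 then x else c (i + k - 2))" for k
  \<comment> \<open>Here \<open>k\<close> and \<open>l\<close> are at least \<open>2\<close>, so the
    truncated subtraction loses nothing.\<close>
  have idx: "Suc (i + k - 2) < m" "i + k - 2 = i + l - 2 \<longleftrightarrow> k = l"
    if "k \<in> {1..n+2}" "k \<noteq> 1" "l \<in> {1..n+2}" "l \<noteq> 1" for k l
    using that \<open>i < j\<close> \<open>j < m\<close> by (auto simp: n_def)
  have "z' ` {1..n+2} \<subseteq> M"
    using zM \<open>i < j\<close> \<open>j < m\<close> by (auto simp: z'_def n_def)
  moreover have "inj_on z' {1..n+2}"
    using zz \<open>i < j\<close> \<open>j < m\<close> by (auto simp: z'_def n_def inj_on_def)
  moreover have "c' k \<bowtie> c' l" if "k \<in> {1..n+2}" "l \<in> {1..n+2}" "k \<noteq> l" for k l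
  proof -
    \<comment> \<open>All points of the crown are shared and hence minimal, so incomparability
      reduces to distinctness.\<close>
    have min: "y = c' k" if "k \<in> {1..n+2}" "y \<preceq> c' k" for k y
      using that xmin cmin[of "i + k - 2"] idx(1)[of k k] by (cases "k = 1") (auto simp: c'_def)
    have "c' k \<noteq> c' l"
    proof (cases "k = 1 \<or> l = 1")
      case True
      then show ?thesis
        using that idx(1)[of k k] idx(1)[of l l] cx[of "i + k - 2"] cx[of "i + l - 2"]
        by (cases "k = 1") (simp_all add: c'_def)
    next
      case False
      then show ?thesis
        using that idx[of k l] idx[of l k] cc[of "i + k - 2" "i + l - 2"] by (simp add: c'_def)
    qed
    then show ?thesis using min that by metis
  qed
  moreover have "c' k \<preceq> z' l \<longleftrightarrow> l = k \<or> Suc l = k \<or> k = 1 \<and> l = n + 2"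
    if "k \<in> {1..n+2}" "l \<in> {1..n+2}" for k l
  proof (cases "k = 1")
    case True
    have "x \<preceq> z (i + l - 1) \<longleftrightarrow> l = 1 \<or> l = n + 2"
    proof -
      have "i + l - 1 < m" "i + l - 1 = i \<longleftrightarrow> l = 1" "i + l - 1 = j \<longleftrightarrow> l = n + 2"
        using that(2) \<open>i < j\<close> \<open>j < m\<close> by (auto simp: n_def)
      then show ?thesis using below_x[of "i + l - 1"] x by metis
    qed
    then show ?thesis using True that(2) by (auto simp: c'_def z'_def)
  next
    case False
    define a where "a = i + k - 2"
    have a: "Suc a < m" "k = a + 2 - i" "i \<le> a"
      using False that(1) \<open>i < j\<close> \<open>j < m\<close> by (auto simp: a_def n_def)
    have "c a \<preceq> z (i + l - 1) \<longleftrightarrow> i + l - 1 = a \<or> i + l - 1 = Suc a"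
      using below_c[of "i + l - 1" a] c[OF a(1)] a that(2) \<open>i < j\<close> \<open>j < m\<close> by (auto simp: n_def)
    moreover have "i + l - 1 = a \<longleftrightarrow> Suc l = k" "i + l - 1 = Suc a \<longleftrightarrow> l = k"
      using False a that by auto
    moreover have "c' k = c a" using False by (simp add: c'_def a_def)
    ultimately show ?thesis using False by (auto simp: z'_def)
  qed
  ultimately have "has_peak_subposet P r (R4_points n) (R4_order n)"
    unfolding has_R4_iff by - (rule exI[of _ z'], rule exI[of _ c'], blast)
  then show False using no_R4 by blast
qed

lemma arrangement:
  obtains vs where "vs \<noteq> []" "distinct vs" "set vs = P" "successively comparable vs"
    "\<And>z. z \<in> M \<Longrightarrow> block vs z"
proof -
  obtain zs where zs: "set zs = M" "distinct zs" "successively joined zs"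
    by (rule max_points_path)
  define z m where "z = (!) zs" and "m = length zs"
  have zM: "z i \<in> M" if "i < m" for i using that zs(1) nth_mem by (auto simp: z_def m_def)
  have inj: "inj_on z {..<m}" using zs(2) by (auto simp: z_def m_def inj_on_def nth_eq_iff_index_eq)
  have "\<forall>i. \<exists>x. Suc i < m \<longrightarrow> x \<preceq> z i \<and> x \<preceq> z (Suc i)"
    using zs(3) by (auto simp: successively_conv_nth z_def m_def)
  then obtain c where c: "\<And>i. Suc i < m \<Longrightarrow> c i \<preceq> z i \<and> c i \<preceq> z (Suc i)" by metis
  have uniq: "j = Suc i \<and> x = c i" if "i < j" "j < m" "x \<preceq> z i" "x \<preceq> z j" for i j x
    by (rule no_crown[of m z c]) (use zM inj c that in auto)
  have "\<exists>vs. distinct vs \<and> set vs = (\<Union>i<m. D (z i)) \<and> successively comparable vs \<and>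
     (0 < m \<and> m < m \<longrightarrow> vs \<noteq> [] \<and> last vs = c (m - 1)) \<and> (\<forall>i<m. block vs (z i))"
  proof (rule arrange_down_sets)
    show "i < m \<Longrightarrow> z i \<in> M" for i by (fact zM)
    show "inj_on z {..<m}" by (fact inj)
    show "Suc i < m \<Longrightarrow> c i \<preceq> z i \<and> c i \<preceq> z (Suc i)" for i by (fact c)
    show "\<lbrakk>i < j; j < m; x \<preceq> z i; x \<preceq> z j\<rbrakk> \<Longrightarrow> j = Suc i \<and> x = c i" for i j x by (fact uniq)
  qed simp
  then obtain vs where vs: "distinct vs" "set vs = (\<Union>i<m. D (z i))" "successively comparable vs"
    "\<forall>i<m. block vs (z i)"
    by (elim exE conjE)
  have Mz: "M = z ` {..<m}" using zs(1) by (auto simp: z_def m_def set_conv_nth)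
  have "set vs = P"
  proof
    show "set vs \<subseteq> P" using vs(2) le_in by auto
    show "P \<subseteq> set vs"
    proof
      fix x assume "x \<in> P"
      then obtain w where "w \<in> M" "x \<preceq> w" by (rule ex_max_above)
      then show "x \<in> set vs" using vs(2) Mz by auto
    qed
  qed
  moreover have "P \<noteq> {}" using connected by (simp add: connected_poset_def)
  ultimately have "vs \<noteq> []" by auto
  show thesis
  proof (rule that)
    show "block vs w" if "w \<in> M" for w using that vs(4) unfolding Mz by auto
  qed fact+
qed

end

section \<open>Paths in quivers\<close>

text \<open>This allows reachability to replace walks. The condition \<open>u \<in> verts G\<close>
  is there because the closure relates everything to itself, vertex or not.\<close>

lemma (in wf_digraph) awalk_iff_rtrancl:
  "(\<exists>p. awalk u p v) \<longleftrightarrow> u \<in> verts G \<and> (u, v) \<in> (arcs_ends G)\<^sup>*"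
proof (intro iffI conjI; (elim exE conjE)?)
  fix p assume "awalk u p v"
  then show "u \<in> verts G" by (simp add: awalk_def)
  from \<open>awalk u p v\<close> show "(u, v) \<in> (arcs_ends G)\<^sup>*"
  proof (induction p arbitrary: u)
    case Nil
    then show ?case by (simp add: awalk_Nil_iff)
  next
    case (Cons a p)
    then have "(u, head G a) \<in> arcs_ends G"
      by (auto simp: awalk_Cons_iff arcs_ends_def arc_to_ends_def)
    moreover have "(head G a, v) \<in> (arcs_ends G)\<^sup>*" using Cons by (simp add: awalk_Cons_iff)
    ultimately show ?case by (rule converse_rtrancl_into_rtrancl)
  qed
next
  assume "u \<in> verts G" "(u, v) \<in> (arcs_ends G)\<^sup>*"
  from this(2,1) show "\<exists>p. awalk u p v"
  proof (induction rule: converse_rtrancl_induct)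
    case base
    then show ?case by (intro exI[of _ "[]"]) (simp add: awalk_Nil_iff)
  next
    case (step u w)
    then obtain a where "a \<in> arcs G" "u = tail G a" "w = head G a"
      by (auto simp: arcs_ends_def arc_to_ends_def)
    moreover obtain p where "awalk w p v" using step.IH calculation by auto
    ultimately have "awalk u (a # p) v" by (simp add: awalk_Cons_iff)
    then show ?case by blast
  qed
qed

lemma supp_I_eq:
  assumes "wf_digraph Q"
  shows "supp_I Q z = {x \<in> verts Q. (x, z) \<in> (arcs_ends Q)\<^sup>*}"
  using wf_digraph.awalk_iff_rtrancl[OF assms] by (auto simp: supp_I_def)

lemma quiver_order_eq:
  assumes "wf_digraph Q"
  shows "quiver_order Q = {(x, y). x \<in> verts Q \<and> (x, y) \<in> (arcs_ends Q)\<^sup>*}"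
  using wf_digraph.awalk_iff_rtrancl[OF assms] by (auto simp: quiver_order_def)

lemma verts_add_arrows [simp]: "verts (add_arrows Q F s t) = verts Q"
  and arcs_add_arrows [simp]: "arcs (add_arrows Q F s t) = arcs Q \<union> F"
  and tail_add_arrows: "tail (add_arrows Q F s t) a = (if a \<in> F then s a else tail Q a)"
  and head_add_arrows: "head (add_arrows Q F s t) a = (if a \<in> F then t a else head Q a)"
  by (simp_all add: add_arrows_def)

lemma arcs_ends_iff: "(x, y) \<in> arcs_ends Q \<longleftrightarrow> (\<exists>a\<in>arcs Q. x = tail Q a \<and> y = head Q a)"
  by (auto simp: arcs_ends_def arc_to_ends_def)

lemma arcs_ends_add_arrows:
  assumes "F \<inter> arcs Q = {}"
  shows "arcs_ends (add_arrows Q F s t) = arcs_ends Q \<union> (\<lambda>a. (s a, t a)) ` F"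
  using assms by (auto simp: arcs_ends_iff tail_add_arrows head_add_arrows) blast+

lemma wf_add_arrows:
  assumes "wf_digraph Q" "s ` F \<subseteq> verts Q" "t ` F \<subseteq> verts Q"
  shows "wf_digraph (add_arrows Q F s t)"
  using assms by unfold_locales
    (auto simp: tail_add_arrows head_add_arrows wf_digraph.tail_in_verts wf_digraph.head_in_verts)

lemma is_sink_iff: "is_sink Q v \<longleftrightarrow> v \<in> verts Q \<and> (\<forall>w. (v, w) \<notin> arcs_ends Q)"
  by (auto simp: is_sink_def out_arcs_def arcs_ends_iff)

lemma is_source_iff: "is_source Q v \<longleftrightarrow> v \<in> verts Q \<and> (\<forall>w. (w, v) \<notin> arcs_ends Q)"
  by (auto simp: is_source_def in_arcs_def arcs_ends_iff)

section \<open>The quiver of an arrangement\<close>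

context finite_poset
begin

definition covers :: "'a rel" where
  "covers = {(x, y). x \<prec> y \<and> (\<forall>w. x \<preceq> w \<and> w \<preceq> y \<longrightarrow> w = x \<or> w = y)}"

text \<open>Induction on the size of the interval: a point strictly between splits it into two
  strictly smaller ones.\<close>

lemma le_imp_covers: "x \<preceq> y \<Longrightarrow> (x, y) \<in> covers\<^sup>*"
proof (induction "card {w. x \<preceq> w \<and> w \<preceq> y}" arbitrary: x y rule: less_induct)
  case less
  show ?case
  proof (cases "x = y \<or> (x, y) \<in> covers")
    case False
    then obtain w where w: "x \<prec> w" "w \<prec> y" using less.prems by (auto simp: covers_def)
    let ?I = "\<lambda>x y. {w. x \<preceq> w \<and> w \<preceq> y}"
    have fin: "finite (?I x y)" by (rule finite_subset[OF _ finite]) (use le_in in auto)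
    have refl: "x \<preceq> x" "y \<preceq> y" using le_in[OF less.prems] le_refl by auto
    have "y \<notin> ?I x w" "x \<notin> ?I w y" using w le_antisym by blast+
    moreover have "?I x w \<subseteq> ?I x y" "?I w y \<subseteq> ?I x y" using w le_trans by blast+
    moreover have "x \<in> ?I x y" "y \<in> ?I x y" using less.prems refl by auto
    ultimately have "?I x w \<subset> ?I x y" "?I w y \<subset> ?I x y" by blast+
    then have "card (?I x w) < card (?I x y)" "card (?I w y) < card (?I x y)"
      using fin psubset_card_mono by blast+
    then have "(x, w) \<in> covers\<^sup>*" "(w, y) \<in> covers\<^sup>*" using less.hyps w by blast+
    then show ?thesis by (rule rtrancl_trans)
  qed auto
qed

text \<open>The common source of acyclicity and of the uniqueness in (c): walks along increasing
  arrows never return.\<close>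

lemma increasing_awalk:
  assumes "wf_digraph G" "arcs_ends G \<subseteq> r - Id" "pre_digraph.awalk G u p v" "p \<noteq> []"
  shows "u \<prec> v"
proof -
  interpret wf_digraph G by fact
  obtain a p' where p: "p = a # p'" using assms(4) by (cases p) auto
  then have a: "(u, head G a) \<in> arcs_ends G" and p': "awalk (head G a) p' v"
    using assms(3) by (auto simp: awalk_Cons_iff arcs_ends_iff)
  have "(x, y) \<in> (arcs_ends G)\<^sup>* \<Longrightarrow> x = y \<or> x \<preceq> y" for x y
    by (induction rule: rtrancl_induct) (use assms(2) le_trans in blast)+
  then have "head G a = v \<or> head G a \<preceq> v" using p' awalk_iff_rtrancl by blast
  then show ?thesis using a assms(2) le_trans le_antisym by blast
qed

text \<open>An arrow is named by the position of its left end, so infinitely many numbers remain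
  free as names of alien arrows.\<close>

definition arrangement_quiver :: "'a list \<Rightarrow> ('a, nat) pre_digraph" where
  "arrangement_quiver vs =
     \<lparr> verts = P, arcs = {..<length vs - 1},
       tail = (\<lambda>i. if vs ! i \<preceq> vs ! Suc i then vs ! i else vs ! Suc i),
       head = (\<lambda>i. if vs ! i \<preceq> vs ! Suc i then vs ! Suc i else vs ! i) \<rparr>"

end

locale arranged_poset = type_A_poset +
  fixes vs :: "'a list"
  assumes vs: "vs \<noteq> []" "distinct vs" "set vs = P" "successively comparable vs"
    and blocks: "\<And>z. z \<in> M \<Longrightarrow> block vs z"
begin

abbreviation "Q \<equiv> arrangement_quiver vs"

lemma path_enumeration_Q: "path_enumeration Q vs"
  unfolding path_enumeration_def
proof (intro conjI exI allI impI)
  show "bij_betw id {..<length vs - 1} (arcs Q)" by (simp add: arrangement_quiver_def)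
qed (use vs in \<open>auto simp: arrangement_quiver_def\<close>)

lemma wf_Q: "wf_digraph Q"
  using vs(3) by unfold_locales (auto simp: arrangement_quiver_def)

lemma Q_increasing: "arcs_ends Q \<subseteq> r - Id"
proof (rule subrelI)
  fix x y assume "(x, y) \<in> arcs_ends Q"
  then obtain i where i: "i < length vs - 1" "x = tail Q i" "y = head Q i"
    by (auto simp: arcs_ends_iff arrangement_quiver_def)
  then have "comparable (vs ! i) (vs ! Suc i)" "vs ! i \<noteq> vs ! Suc i"
    using vs(2,4) by (auto simp: successively_conv_nth nth_eq_iff_index_eq)
  then show "(x, y) \<in> r - Id" using i by (auto simp: arrangement_quiver_def)
qed

lemma consecutive_arrow:
  assumes "vs = us @ x # y # ws"
  shows "x \<prec> y \<Longrightarrow> (x, y) \<in> arcs_ends Q" "y \<prec> x \<Longrightarrow> (y, x) \<in> arcs_ends Q"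
proof -
  have i: "length us < length vs - 1" "vs ! length us = x" "vs ! Suc (length us) = y"
    using assms by (auto simp: nth_append)
  then show "x \<prec> y \<Longrightarrow> (x, y) \<in> arcs_ends Q" "y \<prec> x \<Longrightarrow> (y, x) \<in> arcs_ends Q"
    using le_antisym unfolding arcs_ends_iff
    by (intro bexI[of _ "length us"]; auto simp: arrangement_quiver_def)+
qed

lemma ascending_path:
  "vs = us @ xs @ ws \<Longrightarrow> sorted_wrt (\<prec>) xs \<Longrightarrow> x \<in> set xs \<Longrightarrow> (x, last xs) \<in> (arcs_ends Q)\<^sup>*"
proof (induction xs arbitrary: us x)
  case (Cons a xs)
  show ?case
  proof (cases xs)
    case (Cons b xs')
    have IH: "(y, last xs) \<in> (arcs_ends Q)\<^sup>*" if "y \<in> set xs" for y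
      using Cons.IH[of "us @ [a]" y] Cons.prems that by auto
    have "(a, b) \<in> arcs_ends Q"
      using consecutive_arrow(1)[of us a b "xs' @ ws"] Cons.prems Cons by auto
    then have "(a, last xs) \<in> (arcs_ends Q)\<^sup>*"
      using IH[of b] Cons by (auto intro: converse_rtrancl_into_rtrancl)
    then show ?thesis using IH Cons.prems(3) Cons by auto
  qed (use Cons.prems in auto)
qed simp

lemma descending_path:
  "vs = us @ xs @ ws \<Longrightarrow> sorted_wrt (\<prec>) (rev xs) \<Longrightarrow> x \<in> set xs \<Longrightarrow> (x, hd xs) \<in> (arcs_ends Q)\<^sup>*"
proof (induction xs arbitrary: us x)
  case (Cons a xs)
  show ?case
  proof (cases xs)
    case (Cons b xs')
    have "(b, a) \<in> arcs_ends Q"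
      using consecutive_arrow(2)[of us a b "xs' @ ws"] Cons.prems Cons
      by (auto simp: sorted_wrt_append)
    moreover have "(y, b) \<in> (arcs_ends Q)\<^sup>*" if "y \<in> set xs" for y
      using Cons.IH[of "us @ [a]" y] Cons.prems that Cons by (auto simp: sorted_wrt_append)
    ultimately have "(y, a) \<in> (arcs_ends Q)\<^sup>*" if "y \<in> set xs" for y
      using that by (meson rtrancl.rtrancl_into_rtrancl)
    then show ?thesis using Cons.prems(3) by auto
  qed (use Cons.prems in auto)
qed simp

text \<open>This gives (a): both halves of the block of \<open>z\<close> are directed towards
  \<open>z\<close>, the left one ascending and the right one read backwards.\<close>

lemma path_to_max:
  assumes "z \<in> M" "x \<preceq> z"
  shows "(x, z) \<in> (arcs_ends Q)\<^sup>*"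
proof -
  obtain us ls rs ws where b: "vs = us @ ls @ z # rs @ ws" "set (ls @ z # rs) = D z"
    "sorted_wrt (\<prec>) ls" "sorted_wrt (\<prec>) (rev rs)"
    using blocks[OF assms(1)] unfolding block_def by (elim exE conjE)
  have d: "distinct (ls @ z # rs)" using vs(2) b(1) by auto
  have "y \<prec> z" if "y \<in> set ls \<union> set rs" for y using b(2) d that by auto
  then have s: "sorted_wrt (\<prec>) (ls @ [z])" "sorted_wrt (\<prec>) (rev (z # rs))"
    using b(3,4) by (auto simp: sorted_wrt_append)
  have "x \<in> set (ls @ [z]) \<union> set (z # rs)" using assms(2) b(2) by auto
  then show ?thesis
    using ascending_path[of us "ls @ [z]" "rs @ ws" x, OF _ s(1)]
      descending_path[of "us @ ls" "z # rs" ws x, OF _ s(2)] b(1) by auto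
qed

lemma max_is_sink: "z \<in> M \<Longrightarrow> is_sink Q z"
  using Q_increasing M_in M_max by (auto simp: is_sink_iff arrangement_quiver_def)

text \<open>A source of \<open>Q\<close> inside the path lies below both of its neighbours; were it not minimal,
  it would be below a single maximal point only, contradicting the shape of that block.\<close>

lemma source_extremal:
  assumes "is_source Q y" "x \<prec> y"
  shows "extremal_vertex Q y"
proof (rule ccontr)
  assume "\<not> extremal_vertex Q y"
  then have ends: "y \<noteq> hd vs" "y \<noteq> last vs"
    using path_enumeration_Q unfolding extremal_vertex_def by blast+
  have "y \<in> set vs" using assms(2) le_in vs(3) by auto
  then obtain A B where AB: "vs = A @ y # B" by (auto dest: split_list)
  have "A \<noteq> []" "B \<noteq> []" using AB ends by auto
  then obtain A' p q B' where A: "A = A' @ [p]" and B: "B = q # B'"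
    by (metis append_butlast_last_id list.exhaust)
  \<comment> \<open>Neighbours are joined by an arrow, and no arrow ends in a source, so neither
    neighbour lies below \<open>y\<close>.\<close>
  have np: "\<not> p \<prec> y" using consecutive_arrow(1)[of A' p y B] AB A assms(1) by (auto simp: is_source_iff)
  have nq: "\<not> q \<prec> y" using consecutive_arrow(2)[of A y q B'] AB B assms(1) by (auto simp: is_source_iff)
  have "comparable p y" "comparable y q" using vs(4) unfolding AB A B
    by (simp_all add: successively_append_iff)
  moreover have "p \<noteq> y" "q \<noteq> y" using vs(2) AB A B by auto
  ultimately have "y \<preceq> p" "y \<preceq> q" using np nq by auto
  obtain z where z: "z \<in> M" "p \<preceq> z" using \<open>y \<preceq> p\<close> le_in ex_max_above by blast
  obtain z' where z': "z' \<in> M" "q \<preceq> z'" using \<open>y \<preceq> q\<close> le_in ex_max_above by blast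
  have "y \<preceq> z" "y \<preceq> z'" using \<open>y \<preceq> p\<close> \<open>y \<preceq> q\<close> z z' le_trans by blast+
  \<comment> \<open>As \<open>x\<close> lies strictly below \<open>y\<close>, the point
    \<open>y\<close> is not shared; both neighbours are thus in the block of one maximal
    point.\<close>
  then have "z' = z" using no_R2[OF z(1) z'(1)] assms(2) by blast
  then have q: "q \<preceq> z" using z' by simp
  obtain us ls rs ws where b: "vs = us @ ls @ z # rs @ ws" "set (ls @ z # rs) = D z"
    "sorted_wrt (\<prec>) ls" "sorted_wrt (\<prec>) (rev rs)"
    using blocks[OF z(1)] unfolding block_def by (elim exE conjE)
  have uniq: "A = us' \<and> B = ws'" if "vs = us' @ y # ws'" for us' ws'
    using that vs(2) AB by (metis append_Cons_eq_iff distinct.simps(2) distinct_append not_distinct_conv_prefix)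
  have out: "w \<notin> D z" if "w \<in> set us \<union> set ws" for w
    using that b(1,2) vs(2) by auto
  have "y \<noteq> z" using M_max z \<open>y \<preceq> p\<close> \<open>p \<noteq> y\<close> by blast
  then have "y \<in> set ls \<or> y \<in> set rs" using b(2) \<open>y \<preceq> z\<close> by auto
  then show False
  proof
    \<comment> \<open>On the ascending side the left neighbour \<open>p\<close> either precedes
      \<open>y\<close> in \<open>ls\<close>, hence is below \<open>y\<close>, or lies outside the
      block although \<open>p \<preceq> z\<close>. The other side is its mirror image with
      \<open>q\<close>.\<close>
    assume "y \<in> set ls"
    then obtain l1 l2 where l: "ls = l1 @ y # l2" by (auto dest: split_list)
    have "A = us @ l1" using uniq[of "us @ l1" "l2 @ z # rs @ ws"] b(1) l by auto
    then show False
      using A out[of p] z(2) np b(3) l by (cases l1 rule: rev_cases) (auto simp: sorted_wrt_append)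
  next
    assume "y \<in> set rs"
    then obtain r1 r2 where l: "rs = r1 @ y # r2" by (auto dest: split_list)
    have "B = r2 @ ws" using uniq[of "us @ ls @ z # r1" "r2 @ ws"] b(1) l by auto
    then show False
      using B out[of q] q nq b(4) l by (cases r2) (auto simp: sorted_wrt_append)
  qed
qed

lemma quiver_presentation:
  "\<exists>F s t. alien_set Q F s t \<and> P = verts (add_arrows Q F s t) \<and> r = quiver_order (add_arrows Q F s t)"
proof -
  let ?K = "covers - arcs_ends Q"
  have cov: "covers \<subseteq> r - Id" by (auto simp: covers_def)
  have "r \<subseteq> P \<times> P" using le_in by auto
  then have "finite ?K" using cov finite by (meson Diff_subset finite_SigmaI finite_subset subset_trans)
  then obtain ks where ks: "set ks = ?K" "distinct ks" using finite_distinct_list by blast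
  \<comment> \<open>The arrows of \<open>Q\<close> have smaller numbers, so names from
    \<open>n\<close> on are new.\<close>
  define n where "n = length vs"
  define F where "F = {n..<n + length ks}"
  define s where "s a = fst (ks ! (a - n))" for a
  define t where "t a = snd (ks ! (a - n))" for a
  let ?G = "add_arrows Q F s t"
  have arrow: "(s a, t a) \<in> ?K" if "a \<in> F" for a
  proof -
    have "ks ! (a - n) \<in> set ks" using that by (intro nth_mem) (auto simp: F_def)
    then show ?thesis unfolding ks(1) by (simp add: s_def t_def)
  qed
  \<comment> \<open>Parallel alien arrows would violate (c); they do not arise because
    \<open>ks\<close> lists every cover once.\<close>
  have inj: "a = b" if "a \<in> F" "b \<in> F" "s a = s b" "t a = t b" for a b
  proof -
    have "ks ! (a - n) = ks ! (b - n)" using that by (auto simp: s_def t_def prod_eq_iff)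
    then show ?thesis using that(1,2) ks(2) by (auto simp: F_def nth_eq_iff_index_eq)
  qed
  have K: "(\<lambda>a. (s a, t a)) ` F = ?K"
  proof
    show "(\<lambda>a. (s a, t a)) ` F \<subseteq> ?K" using arrow by blast
    show "?K \<subseteq> (\<lambda>a. (s a, t a)) ` F"
    proof
      fix e assume "e \<in> ?K"
      then obtain i where "i < length ks" "e = ks ! i" using ks(1) by (metis in_set_conv_nth)
      then show "e \<in> (\<lambda>a. (s a, t a)) ` F"
        by (intro image_eqI[of _ _ "n + i"]) (auto simp: s_def t_def F_def)
    qed
  qed
  have F: "finite F" "F \<inter> arcs Q = {}" by (auto simp: F_def n_def arrangement_quiver_def)
  have lt: "s a \<prec> t a" if "a \<in> F" for a using arrow[OF that] cov by blast
  have V: "verts Q = P" by (simp add: arrangement_quiver_def)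
  have st: "s ` F \<subseteq> verts Q" "t ` F \<subseteq> verts Q" using lt le_in V by blast+
  have wfG: "wf_digraph ?G" using wf_Q st by (rule wf_add_arrows)
  then interpret G: wf_digraph ?G .
  have ends: "arcs_ends ?G = arcs_ends Q \<union> covers"
    using arcs_ends_add_arrows[OF F(2)] K by blast
  then have inc: "arcs_ends ?G \<subseteq> r - Id" using Q_increasing cov by blast
  have "r = quiver_order ?G"
  proof (rule set_eqI, clarify)
    fix x y
    have "(x, y) \<in> (arcs_ends ?G)\<^sup>* \<Longrightarrow> x \<in> P \<Longrightarrow> x \<preceq> y"
      by (induction rule: rtrancl_induct) (use inc le_refl le_trans in blast)+
    moreover have "x \<preceq> y \<Longrightarrow> (x, y) \<in> (arcs_ends ?G)\<^sup>*"
      using le_imp_covers[of x y] rtrancl_mono[of covers "arcs_ends ?G"] ends by auto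
    ultimately show "x \<preceq> y \<longleftrightarrow> (x, y) \<in> quiver_order ?G"
      using le_in(1) by (auto simp: quiver_order_eq[OF wfG] V)
  qed
  moreover have "alien_set Q F s t"
    unfolding alien_set_def
  proof (intro conjI ballI allI impI)
    fix a assume a: "a \<in> F"
    obtain z where z: "z \<in> M" "t a \<preceq> z" using lt[OF a] le_in ex_max_above by blast
    then have "s a \<preceq> z" using lt[OF a] le_trans by blast
    then show "\<exists>z. is_sink Q z \<and> s a \<in> supp_I Q z \<and> t a \<in> supp_I Q z"
      using z path_to_max max_is_sink le_in(1) by (auto simp: supp_I_eq[OF wf_Q] V intro!: exI[of _ z])
  next
    fix a assume "a \<in> F" "is_source Q (t a)"
    then show "extremal_vertex Q (t a)" using source_extremal lt by blast
  next
    fix a p assume a: "a \<in> F"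
    show "G.awalk (s a) p (t a) \<longleftrightarrow> p = [a]"
    proof
      assume "p = [a]"
      then show "G.awalk (s a) p (t a)"
        using a st by (auto simp: G.awalk_Cons_iff G.awalk_Nil_iff tail_add_arrows head_add_arrows)
    next
      assume p: "G.awalk (s a) p (t a)"
      have "p \<noteq> []" using p lt[OF a] by (auto simp: G.awalk_Nil_iff)
      then obtain b p' where p': "p = b # p'" by (cases p) auto
      then have b: "b \<in> arcs ?G" "tail ?G b = s a" "G.awalk (head ?G b) p' (t a)"
        using p by (auto simp: G.awalk_Cons_iff)
      then have "(s a, head ?G b) \<in> arcs_ends ?G" unfolding arcs_ends_iff by metis
      then have sb: "s a \<prec> head ?G b" using inc by blast
      have "head ?G b = t a \<or> head ?G b \<prec> t a"
        using b(3) increasing_awalk[OF wfG inc b(3)] by (cases "p' = []") (auto simp: G.awalk_Nil_iff)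
      \<comment> \<open>The first arrow of \<open>p\<close> ends inside the interval from
        \<open>s a\<close> to \<open>t a\<close>, which has no inner point. So \<open>p\<close> is a
        single arrow, and an alien one, since the pair is not an arrow of \<open>Q\<close>.\<close>
      then have tb: "head ?G b = t a" 
      proof
        assume "head ?G b \<prec> t a"
        moreover have "\<forall>w. s a \<preceq> w \<and> w \<preceq> t a \<longrightarrow> w = s a \<or> w = t a"
          using arrow[OF a] by (simp add: covers_def)
        ultimately show ?thesis using sb by metis
      qed
      then have "p' = []" using increasing_awalk[OF wfG inc b(3)] by auto
      have "b \<in> F"
      proof (rule ccontr)
        assume "b \<notin> F"
        then have "b \<in> arcs Q" "tail Q b = s a" "head Q b = t a"
          using b(1,2) tb by (auto simp: tail_add_arrows head_add_arrows)
        then have "(s a, t a) \<in> arcs_ends Q" unfolding arcs_ends_iff by metis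
        then show False using arrow[OF a] by blast
      qed
      then have "b = a" using inj[OF _ a] b(2) tb by (simp add: tail_add_arrows head_add_arrows)
      then show "p = [a]" using p' \<open>p' = []\<close> by simp
    qed
  next
    show "acyclic_quiver ?G"
      unfolding acyclic_quiver_def G.cycle_def
    proof (intro notI, elim exE conjE)
      fix p u assume "G.awalk u p u" "p \<noteq> []"
      then show False using increasing_awalk[OF wfG inc] by blast
    qed
  qed (use F st in auto)
  ultimately show ?thesis using V by (intro exI[of _ F] exI[of _ s] exI[of _ t]) simp
qed

end

section \<open>Posets of alien sets\<close>

text \<open>This isolates what the converse needs from the quiver: a coordinate \<open>pos\<close>
  along the path in which the points below \<open>z\<close> ascend towards \<open>z\<close> from
  both sides, and shared points are minimal and lie between their maximal points.\<close>

lemma (in finite_poset) type_A_if_positions: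
  fixes pos :: "'a \<Rightarrow> nat"
  assumes connected: "connected_poset P r" and inj: "inj_on pos M"
    and left: "\<And>x y z. \<lbrakk>z \<in> M; x \<preceq> z; y \<preceq> z; pos x \<le> pos y; pos y \<le> pos z\<rbrakk> \<Longrightarrow> x \<preceq> y"
    and right: "\<And>x y z. \<lbrakk>z \<in> M; x \<preceq> z; y \<preceq> z; pos z \<le> pos y; pos y \<le> pos x\<rbrakk> \<Longrightarrow> x \<preceq> y"
    and shared: "\<And>x z z'. \<lbrakk>z \<in> M; z' \<in> M; x \<preceq> z; x \<preceq> z'; pos z < pos z'\<rbrakk> \<Longrightarrow>
      pos z < pos x \<and> pos x < pos z' \<and> (\<forall>y. y \<preceq> x \<longrightarrow> y = x)"
  shows "type_A_poset P r"
proof unfold_locales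
  have pos: "pos z < pos z' \<or> pos z' < pos z" if "z \<in> M" "z' \<in> M" "z \<noteq> z'" for z z'
    using inj that by (metis inj_onD linorder_neqE_nat)
  \<comment> \<open>Of three points below \<open>z\<close>, two are on the same side, which excludes
    the first pattern.\<close>
  have side: "comparable x y" if "z \<in> M" "x \<preceq> z" "y \<preceq> z" "pos x \<le> pos z \<longleftrightarrow> pos y \<le> pos z" for x y z
    using left[of z x y] left[of z y x] right[of z x y] right[of z y x] that by linarith
  show "connected_poset P r" by fact
  show False if "z \<in> M" "x \<preceq> z" "y \<preceq> z" "w \<preceq> z" "x \<bowtie> y" "x \<bowtie> w" "y \<bowtie> w" for x y z w
    using side[of z x y] side[of z x w] side[of z y w] that by blast
  show "x = y" if "z \<in> M" "z' \<in> M" "z \<noteq> z'" "y \<preceq> z" "y \<preceq> z'" "x \<preceq> y" for x y z z'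
    using pos[of z z'] shared[of z z' y] shared[of z' z y] that by blast
  \<comment> \<open>The point \<open>x\<close> would have to lie both to the left and to the right
    of the middle one \<open>v\<close>.\<close>
  have three: False
    if "u \<in> M" "v \<in> M" "w \<in> M" "x \<preceq> u" "x \<preceq> v" "x \<preceq> w" "pos u < pos v" "pos v < pos w" for u v w x
    using shared[of u v x] shared[of v w x] that by auto
  show "u = v \<or> u = w \<or> v = w"
    if "u \<in> M" "v \<in> M" "w \<in> M" "x \<preceq> u" "x \<preceq> v" "x \<preceq> w" for u v w x
  proof (rule ccontr)
    assume "\<not> ?thesis"
    then have "pos u < pos v \<or> pos v < pos u" "pos u < pos w \<or> pos w < pos u"
      "pos v < pos w \<or> pos w < pos v" using pos that by blast+
    then show False
      using three[of u v w x] three[of u w v x] three[of v u w x] three[of v w u x]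
        three[of w u v x] three[of w v u x] that by blast
  qed
  show "\<not> has_peak_subposet P r (R4_points n) (R4_order n)" for n
  proof
    let ?I = "{1..n+2}"
    assume "has_peak_subposet P r (R4_points n) (R4_order n)"
    then obtain z c where zM: "z ` ?I \<subseteq> M" and zi: "inj_on z ?I"
      and cc: "\<forall>i\<in>?I. \<forall>j\<in>?I. i \<noteq> j \<longrightarrow> c i \<bowtie> c j"
      and cz: "\<forall>i\<in>?I. \<forall>j\<in>?I. c i \<preceq> z j \<longleftrightarrow> j = i \<or> Suc j = i \<or> i = 1 \<and> j = n + 2"
      unfolding has_R4_iff by (elim exE conjE)
    have "finite ((pos \<circ> z) ` ?I)" "(pos \<circ> z) ` ?I \<noteq> {}" by auto
    then have "Max ((pos \<circ> z) ` ?I) \<in> (pos \<circ> z) ` ?I"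
      "\<And>p. p \<in> (pos \<circ> z) ` ?I \<Longrightarrow> p \<le> Max ((pos \<circ> z) ` ?I)" by (rule Max_in, simp_all)
    \<comment> \<open>\<open>z j\<close> is the rightmost star of the crown.\<close>
    then obtain j where j: "j \<in> ?I" "\<And>k. k \<in> ?I \<Longrightarrow> pos (z k) \<le> pos (z j)" by fastforce
    have less: "pos (c i) < pos (z j)" if i: "i \<in> ?I" "c i \<preceq> z j" for i
    proof -
      \<comment> \<open>The index of the other star above \<open>c i\<close>. It is to the left of
        \<open>z j\<close>, so \<open>c i\<close> lies between the two.\<close>
      define k where "k = (if j = i then (if i = 1 then n + 2 else i - 1) else i)"
      have k: "k \<in> ?I" "k \<noteq> j" "k = i \<or> Suc k = i \<or> i = 1 \<and> k = n + 2"
        using i(1) by (auto simp: k_def)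
      then have "c i \<preceq> z k" using cz i(1) by blast
      moreover have "z k \<noteq> z j" using zi k(1,2) j(1) by (auto dest: inj_onD)
      moreover have "z k \<in> M" "z j \<in> M" using zM k(1) j(1) by blast+
      ultimately show ?thesis
        using shared[of "z k" "z j" "c i"] pos[of "z k" "z j"] j(2)[OF k(1)] i(2) by linarith
    qed
    \<comment> \<open>\<open>c l\<close> and \<open>c j\<close> are the two crown points below
      \<open>z j\<close>, read cyclically.\<close>
    define l where "l = (if j = n + 2 then 1 else Suc j)"
    have l: "l \<in> ?I" "l \<noteq> j" "j = l \<or> Suc j = l \<or> l = 1 \<and> j = n + 2"
      using j(1) by (auto simp: l_def)
    then have "c l \<preceq> z j" "c j \<preceq> z j" using cz j(1) by blast+
    then have "comparable (c l) (c j)"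
      using side[of "z j" "c l" "c j"] less[of l] less[of j] l(1) j(1) zM by fastforce
    then show False using cc l(1,2) j(1) by blast
  qed
qed

section \<open>Arrows and neighbours in a quiver on a path\<close>

lemma path_enumeration_arrow:
  assumes "path_enumeration Q vs" "(x, y) \<in> arcs_ends Q"
  obtains k where "Suc k < length vs" "x = vs ! k \<and> y = vs ! Suc k \<or> x = vs ! Suc k \<and> y = vs ! k"
proof -
  obtain e where e: "bij_betw e {..<length vs - 1} (arcs Q)"
    "\<forall>i < length vs - 1. {tail Q (e i), head Q (e i)} = {vs ! i, vs ! Suc i}"
    using assms(1) by (auto simp: path_enumeration_def)
  obtain a where "a \<in> arcs Q" "x = tail Q a" "y = head Q a"
    using assms(2) by (auto simp: arcs_ends_iff)
  moreover then obtain i where "i < length vs - 1" "a = e i"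
    using e(1) by (auto simp: bij_betw_def)
  ultimately show thesis using that[of i] e(2) by (auto simp: doubleton_eq_iff)
qed

lemma path_enumeration_adjacent:
  assumes "path_enumeration Q vs" "Suc k < length vs"
  shows "(vs ! k, vs ! Suc k) \<in> arcs_ends Q \<or> (vs ! Suc k, vs ! k) \<in> arcs_ends Q"
proof -
  obtain e where e: "bij_betw e {..<length vs - 1} (arcs Q)"
    "\<forall>i < length vs - 1. {tail Q (e i), head Q (e i)} = {vs ! i, vs ! Suc i}"
    using assms(1) by (auto simp: path_enumeration_def)
  have k: "k < length vs - 1" using assms(2) by simp
  then have "e k \<in> arcs Q" using e(1) by (auto simp: bij_betw_def)
  moreover have "tail Q (e k) = vs ! k \<and> head Q (e k) = vs ! Suc k \<or>
      tail Q (e k) = vs ! Suc k \<and> head Q (e k) = vs ! k"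
    using e(2) k by (simp add: doubleton_eq_iff)
  ultimately show ?thesis unfolding arcs_ends_iff by metis
qed

lemma wf_path_enumeration: "path_enumeration Q vs \<Longrightarrow> wf_digraph Q"
proof
  fix a assume p: "path_enumeration Q vs" and "a \<in> arcs Q"
  then have "(tail Q a, head Q a) \<in> arcs_ends Q" by (auto simp: arcs_ends_iff)
  from p this obtain k where "Suc k < length vs"
    "tail Q a = vs ! k \<and> head Q a = vs ! Suc k \<or> tail Q a = vs ! Suc k \<and> head Q a = vs ! k"
    by (rule path_enumeration_arrow)
  then have "tail Q a \<in> set vs" "head Q a \<in> set vs" by auto
  then show "tail Q a \<in> verts Q" "head Q a \<in> verts Q" using p by (auto simp: path_enumeration_def)
qed

text \<open>\<open>extremal_vertex\<close> brings its own enumeration, which need not be the one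
  fixed elsewhere. An end of a path has at most one neighbour, and this formulation mentions no
  enumeration.\<close>

lemma extremal_vertex_out:
  assumes "extremal_vertex Q x" "(x, u) \<in> arcs_ends Q" "(x, w) \<in> arcs_ends Q"
  shows "u = w"
proof -
  obtain vs where vs: "path_enumeration Q vs" "x = hd vs \<or> x = last vs"
    using assms(1) by (auto simp: extremal_vertex_def)
  then have d: "distinct vs" "vs \<noteq> []" by (auto simp: path_enumeration_def)
  then have x: "x = vs ! 0 \<or> x = vs ! (length vs - 1)"
    using vs(2) by (auto simp: hd_conv_nth last_conv_nth)
  obtain i where i: "Suc i < length vs" "x = vs ! i \<and> u = vs ! Suc i \<or> x = vs ! Suc i \<and> u = vs ! i"
    using vs(1) assms(2) by (rule path_enumeration_arrow)
  obtain j where j: "Suc j < length vs" "x = vs ! j \<and> w = vs ! Suc j \<or> x = vs ! Suc j \<and> w = vs ! j"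
    using vs(1) assms(3) by (rule path_enumeration_arrow)
  have "i = j" using x i j d by (auto simp: nth_eq_iff_index_eq)
  then show ?thesis using i j d by (auto simp: nth_eq_iff_index_eq)
qed

locale alien_quiver = finite_poset P r for P :: "'a set" and r +
  fixes Q :: "('a, 'b) pre_digraph" and F s t vs
  assumes path: "path_enumeration Q vs" and alien: "alien_set Q F s t"
    and P_eq: "P = verts Q" and r_eq: "r = quiver_order (add_arrows Q F s t)"
begin

abbreviation "G \<equiv> add_arrows Q F s t"
abbreviation "n \<equiv> length vs"
abbreviation "up k \<equiv> (vs ! k, vs ! Suc k) \<in> arcs_ends Q"
abbreviation "down k \<equiv> (vs ! Suc k, vs ! k) \<in> arcs_ends Q"

lemma vs: "vs \<noteq> []" "distinct vs" "set vs = P"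
  using path P_eq by (auto simp: path_enumeration_def)

lemma wf_Q: "wf_digraph Q"
  using path by (rule wf_path_enumeration)

lemma r_iff: "x \<preceq> y \<longleftrightarrow> x \<in> P \<and> (x, y) \<in> (arcs_ends G)\<^sup>*"
  using alien wf_add_arrows[OF wf_Q] unfolding alien_set_def r_eq P_eq
  by (subst quiver_order_eq) auto

lemma ends_G: "arcs_ends G = arcs_ends Q \<union> (\<lambda>a. (s a, t a)) ` F"
  using alien by (intro arcs_ends_add_arrows) (simp add: alien_set_def)

lemma Q_path_le: "(x, y) \<in> (arcs_ends Q)\<^sup>* \<Longrightarrow> x \<in> P \<Longrightarrow> x \<preceq> y"
  using ends_G rtrancl_mono[of "arcs_ends Q" "arcs_ends G"] by (auto simp: r_iff)

lemma nth_eq: "i < n \<Longrightarrow> j < n \<Longrightarrow> vs ! i = vs ! j \<longleftrightarrow> i = j"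
  using vs(2) by (rule nth_eq_iff_index_eq)

text \<open>Opposite arrows would identify two neighbours by antisymmetry of
  \<open>r\<close>.\<close>

lemma not_up_down: "Suc k < n \<Longrightarrow> up k \<Longrightarrow> down k \<Longrightarrow> False"
  using Q_path_le[OF r_into_rtrancl, of "vs ! k" "vs ! Suc k"]
    Q_path_le[OF r_into_rtrancl, of "vs ! Suc k" "vs ! k"] vs(3)
    le_antisym[of "vs ! k" "vs ! Suc k"] nth_eq[of k "Suc k"] by auto

text \<open>A directed walk along a path graph cannot turn back, since the edge of the turn would
  need both orientations.\<close>

lemma path_shape:
  assumes "(vs ! i, y) \<in> (arcs_ends Q)\<^sup>*" "i < n"
  shows "\<exists>j<n. y = vs ! j \<and> (i \<le> j \<and> (\<forall>k. i \<le> k \<and> k < j \<longrightarrow> up k) \<or>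
     j \<le> i \<and> (\<forall>k. j \<le> k \<and> k < i \<longrightarrow> down k))"
  using assms(1)
proof (induction rule: rtrancl_induct)
  case base
  then show ?case using assms(2) by auto
next
  case (step y y')
  then obtain j where j: "j < n" "y = vs ! j" "i \<le> j \<and> (\<forall>k. i \<le> k \<and> k < j \<longrightarrow> up k) \<or>
     j \<le> i \<and> (\<forall>k. j \<le> k \<and> k < i \<longrightarrow> down k)" by blast
  from path step.hyps(2) obtain l where l: "Suc l < n" "y = vs ! l \<and> y' = vs ! Suc l \<or> y = vs ! Suc l \<and> y' = vs ! l"
    by (rule path_enumeration_arrow)
  from l(2) show ?case
  proof
    assume a: "y = vs ! l \<and> y' = vs ! Suc l"
    then have "vs ! l = vs ! j" using j(2) by metis
    then have "l = j" using nth_eq[OF Suc_lessD[OF l(1)] j(1)] by blast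
    then have "up j" using a step.hyps(2) by simp
    have "i \<le> j"
    proof (rule ccontr)
      assume "\<not> i \<le> j"
      then have "down j" using j(3) by auto
      then show False using not_up_down[of j] \<open>up j\<close> l(1) \<open>l = j\<close> by simp
    qed
    then have "up k" if "i \<le> k" "k < Suc j" for k
      using j(3) \<open>up j\<close> that by (cases "k = j") auto
    then show ?thesis using a l(1) \<open>l = j\<close> \<open>i \<le> j\<close> by (intro exI[of _ "Suc j"]) auto
  next
    assume a: "y = vs ! Suc l \<and> y' = vs ! l"
    then have "vs ! Suc l = vs ! j" using j(2) by metis
    then have "Suc l = j" using nth_eq[OF l(1) j(1)] by blast
    then have "down l" using a step.hyps(2) by simp
    have "j \<le> i"
    proof (rule ccontr)
      assume "\<not> j \<le> i"
      then have "up l" using j(3) \<open>Suc l = j\<close> by auto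
      then show False using not_up_down[of l] \<open>down l\<close> l(1) by simp
    qed
    then have "down k" if "l \<le> k" "k < i" for k
      using j(3) \<open>down l\<close> that \<open>Suc l = j\<close> by (cases "k = l") auto
    then show ?thesis using a l(1) \<open>Suc l = j\<close> \<open>j \<le> i\<close> by (intro exI[of _ l]) auto
  qed
qed

definition pos where "pos x = (THE i. i < n \<and> vs ! i = x)"

lemma pos_nth: "i < n \<Longrightarrow> pos (vs ! i) = i"
  unfolding pos_def using nth_eq by (intro the_equality) auto

lemma pos: "x \<in> P \<Longrightarrow> pos x < n" "x \<in> P \<Longrightarrow> vs ! pos x = x"
  using vs(3) pos_nth by (metis in_set_conv_nth)+

lemma path_shape_pos:
  assumes "(x, y) \<in> (arcs_ends Q)\<^sup>*" "x \<in> P"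
  shows "y \<in> P"
    and "pos x \<le> pos y \<and> (\<forall>k. pos x \<le> k \<and> k < pos y \<longrightarrow> up k) \<or>
      pos y \<le> pos x \<and> (\<forall>k. pos y \<le> k \<and> k < pos x \<longrightarrow> down k)"
proof -
  obtain j where "j < n" "y = vs ! j" "pos x \<le> j \<and> (\<forall>k. pos x \<le> k \<and> k < j \<longrightarrow> up k) \<or>
      j \<le> pos x \<and> (\<forall>k. j \<le> k \<and> k < pos x \<longrightarrow> down k)"
    using path_shape[of "pos x" y] assms pos by auto
  moreover have "pos y = j" using calculation pos_nth by simp
  ultimately show "y \<in> P" "pos x \<le> pos y \<and> (\<forall>k. pos x \<le> k \<and> k < pos y \<longrightarrow> up k) \<or>
      pos y \<le> pos x \<and> (\<forall>k. pos y \<le> k \<and> k < pos x \<longrightarrow> down k)"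
    using vs(3) by auto
qed

lemma up_path: "i \<le> j \<Longrightarrow> (\<And>k. i \<le> k \<Longrightarrow> k < j \<Longrightarrow> up k) \<Longrightarrow> (vs ! i, vs ! j) \<in> (arcs_ends Q)\<^sup>*"
proof (induction j rule: dec_induct)
  case (step j)
  then show ?case by (meson less_SucI lessI rtrancl.rtrancl_into_rtrancl)
qed simp

lemma down_path: "i \<le> j \<Longrightarrow> (\<And>k. i \<le> k \<Longrightarrow> k < j \<Longrightarrow> down k) \<Longrightarrow> (vs ! j, vs ! i) \<in> (arcs_ends Q)\<^sup>*"
proof (induction j rule: dec_induct)
  case (step j)
  then show ?case by (meson less_SucI lessI converse_rtrancl_into_rtrancl)
qed simp

text \<open>If \<open>x\<close> were not strictly between the sinks, its walk to the farther one
  would pass through the nearer one and leave it again. Between them, both edges at \<open>x\<close>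
  point away from it.\<close>

lemma sink_between:
  assumes "is_sink Q z" "is_sink Q z'" "(x, z) \<in> (arcs_ends Q)\<^sup>*" "(x, z') \<in> (arcs_ends Q)\<^sup>*"
    and x: "x \<in> P" and less: "pos z < pos z'"
  shows "pos z < pos x" "pos x < pos z'" "is_source Q x" "\<not> extremal_vertex Q x"
proof -
  have zP: "z \<in> P" "z' \<in> P" using assms(1,2) P_eq by (auto simp: is_sink_def)
  have out: "(z, w) \<notin> arcs_ends Q" "(z', w) \<notin> arcs_ends Q" for w
    using assms(1,2) by (auto simp: is_sink_iff)
  note shape = path_shape_pos(2)[OF assms(3) x] path_shape_pos(2)[OF assms(4) x]
  show 1: "pos z < pos x"
  proof (rule ccontr)
    assume "\<not> pos z < pos x"
    then have "up (pos z)" using shape(2) less by auto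
    then show False using out(1) pos(2)[OF zP(1)] by simp
  qed
  show 2: "pos x < pos z'"
  proof (rule ccontr)
    assume "\<not> pos x < pos z'"
    moreover obtain q where q: "pos z' = Suc q" using less by (cases "pos z'") auto
    ultimately have "pos z \<le> q" "q < pos x" using less by auto
    then have "down q" using shape(1) by auto
    then show False using out(2)[of "vs ! q"] pos(2)[OF zP(2)] q by metis
  qed
  have n: "Suc (pos x) < n" using 2 pos(1)[OF zP(2)] by simp
  define p where "p = pos x - 1"
  have p: "Suc p = pos x" using 1 by (simp add: p_def)
  have "pos z \<le> p" "p < pos x" using 1 p by auto
  then have "down p" using shape(1) by auto
  have "up (pos x)" using shape(2) 2 by auto
  show "is_source Q x"
    unfolding is_source_iff
  proof (intro conjI allI notI)
    show "x \<in> verts Q" using x P_eq by simp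
    fix w assume w: "(w, x) \<in> arcs_ends Q"
    from path w obtain k where k: "Suc k < n" "w = vs ! k \<and> x = vs ! Suc k \<or> w = vs ! Suc k \<and> x = vs ! k"
      by (rule path_enumeration_arrow)
    then consider "pos x = Suc k" "up k" | "pos x = k" "down k"
      using w pos_nth by auto
    then show False
    proof cases
      case 1
      then have "k = p" using p by simp
      then show False using not_up_down[of k] 1 k(1) \<open>down p\<close> by simp
    next
      case 2
      then show False using not_up_down[of k] k(1) \<open>up (pos x)\<close> by simp
    qed
  qed
  show "\<not> extremal_vertex Q x"
  proof
    assume "extremal_vertex Q x"
    \<comment> \<open>Two different out-neighbours are impossible at an end of the path.\<close>
    then have "vs ! p = vs ! Suc (pos x)"
      using extremal_vertex_out[of Q x] \<open>down p\<close> \<open>up (pos x)\<close> p pos(2)[OF x] by auto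
    then show False using nth_eq[of p "Suc (pos x)"] n p by simp
  qed
qed

lemma alien_arrow:
  assumes "a \<in> F"
  obtains z where "is_sink Q z" "(s a, z) \<in> (arcs_ends Q)\<^sup>*" "(t a, z) \<in> (arcs_ends Q)\<^sup>*"
    "s a \<in> P" "t a \<in> P" "is_source Q (t a) \<Longrightarrow> extremal_vertex Q (t a)"
proof -
  have "\<forall>\<alpha>\<in>F. \<exists>z. is_sink Q z \<and> s \<alpha> \<in> supp_I Q z \<and> t \<alpha> \<in> supp_I Q z"
    "\<forall>\<alpha>\<in>F. is_source Q (t \<alpha>) \<longrightarrow> extremal_vertex Q (t \<alpha>)"
    using alien unfolding alien_set_def by blast+
  then show thesis using assms that P_eq unfolding supp_I_eq[OF wf_Q] by blast
qed

text \<open>For a loop, the trivial path would be a second path besides the arrow, against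
  (c).\<close>

lemma alien_no_loop: "a \<in> F \<Longrightarrow> s a \<noteq> t a"
proof
  assume a: "a \<in> F" "s a = t a"
  have "s a \<in> verts G" using alien a(1) by (auto simp: alien_set_def)
  then have "pre_digraph.awalk G (s a) [] (t a)"
    using a(2) by (simp add: pre_digraph.awalk_def pre_digraph.cas.simps)
  moreover have "\<forall>\<alpha>\<in>F. \<forall>p. pre_digraph.awalk G (s \<alpha>) p (t \<alpha>) \<longleftrightarrow> p = [\<alpha>]"
    using alien unfolding alien_set_def by blast
  ultimately show False using a(1) by blast
qed

text \<open>Each alien arrow of a walk to \<open>z\<close> can be bypassed in \<open>Q\<close>,
  working backwards from \<open>z\<close>: its target reaches \<open>z\<close> and the sink from
  (a), these coincide, and the starting vertex reaches the latter in \<open>Q\<close>.\<close>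

lemma sink_path:
  assumes "is_sink Q z" "x \<preceq> z"
  shows "(x, z) \<in> (arcs_ends Q)\<^sup>*"
proof -
  have "(x, z) \<in> (arcs_ends G)\<^sup>*" using assms(2) r_iff by simp
  then show ?thesis
  proof (induction rule: converse_rtrancl_induct)
    case (step x y)
    from step.hyps(1) consider "(x, y) \<in> arcs_ends Q" | a where "a \<in> F" "x = s a" "y = t a"
      using ends_G by auto
    then show ?case
    proof cases
      case 1
      then show ?thesis using step.IH by (rule converse_rtrancl_into_rtrancl)
    next
      case 2
      obtain z' where z': "is_sink Q z'" "(x, z') \<in> (arcs_ends Q)\<^sup>*" "(y, z') \<in> (arcs_ends Q)\<^sup>*"
        "y \<in> P" "is_source Q y \<Longrightarrow> extremal_vertex Q y"
        using alien_arrow[OF 2(1)] 2 by metis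
      \<comment> \<open>If the sinks differed, the target \<open>y\<close> would be a source of
        \<open>Q\<close> that is not extremal, which (b) forbids.\<close>
      have "pos z = pos z'"
        using sink_between[OF assms(1) z'(1) step.IH z'(3) z'(4)]
          sink_between[OF z'(1) assms(1) z'(3) step.IH z'(4)] z'(5) by (meson linorder_neqE_nat)
      moreover have "z \<in> P" "z' \<in> P" using assms(1) z'(1) P_eq by (auto simp: is_sink_def)
      ultimately have "z = z'" using pos(2) by metis
      then show ?thesis using z'(2) by simp
    qed
  qed simp
qed

text \<open>An alien arrow leaving a sink \<open>z\<close> must by (a) end in a vertex that reaches
  \<open>z\<close> itself, which closes a cycle.\<close>

lemma max_iff_sink: "z \<in> M \<longleftrightarrow> is_sink Q z"
proof
  assume z: "z \<in> M"
  have "(z, w) \<notin> arcs_ends Q" for w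
  proof
    assume w: "(z, w) \<in> arcs_ends Q"
    then have "z \<preceq> w" using Q_path_le[of z w] M_in[OF z] by auto
    then have "w = z" using M_max[OF z] by simp
    with path w obtain k where "Suc k < n" "vs ! k = vs ! Suc k"
      by (metis path_enumeration_arrow)
    then show False using nth_eq[of k "Suc k"] by simp
  qed
  then show "is_sink Q z" using M_in[OF z] P_eq by (simp add: is_sink_iff)
next
  assume z: "is_sink Q z"
  have "y = z" if "z \<preceq> y" for y
  proof (rule ccontr)
    assume "y \<noteq> z"
    moreover have "(z, y) \<in> (arcs_ends G)\<^sup>*" using that r_iff by simp
    ultimately obtain w where "(z, w) \<in> arcs_ends G" by (metis converse_rtranclE)
    then obtain a where a: "a \<in> F" "z = s a" "w = t a"
      using z ends_G by (auto simp: is_sink_iff)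
    obtain z' where z': "(z, z') \<in> (arcs_ends Q)\<^sup>*" "(w, z') \<in> (arcs_ends Q)\<^sup>*" "w \<in> P"
      using alien_arrow[OF a(1)] a by metis
    have "z' = z" using z'(1) z by (metis converse_rtranclE is_sink_iff)
    then have "w \<preceq> z" using Q_path_le z' by simp
    moreover have "z \<preceq> w"
      using \<open>(z, w) \<in> arcs_ends G\<close> z P_eq by (auto simp: r_iff is_sink_iff)
    ultimately show False using alien_no_loop[OF a(1)] a le_antisym by blast
  qed
  then show "z \<in> M" using z P_eq by (auto simp: max_points_def is_sink_iff)
qed

text \<open>The last arrow of a nontrivial walk into a source of \<open>Q\<close> is alien, and (b)
  permits this only at an extremal vertex.\<close>

lemma source_minimal:
  assumes "is_source Q x" "\<not> extremal_vertex Q x" "y \<preceq> x"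
  shows "y = x"
proof (rule ccontr)
  assume "y \<noteq> x"
  moreover have "(y, x) \<in> (arcs_ends G)\<^sup>*" using assms(3) r_iff by simp
  ultimately obtain w where "(w, x) \<in> arcs_ends G" by (metis rtranclE)
  then obtain a where "a \<in> F" "x = t a" using assms(1) ends_G by (auto simp: is_source_iff)
  then show False using alien_arrow assms(1,2) by metis
qed

lemma nth_connected: "i < n \<Longrightarrow> (vs ! 0, vs ! i) \<in> (Restr (r \<union> r\<inverse>) P)\<^sup>*"
proof (induction i)
  case (Suc i)
  have "vs ! i \<in> P" "vs ! Suc i \<in> P" using Suc.prems vs(3) by auto
  moreover have "comparable (vs ! i) (vs ! Suc i)"
    using path_enumeration_adjacent[OF path Suc.prems] Q_path_le calculation by blast
  ultimately have "(vs ! i, vs ! Suc i) \<in> Restr (r \<union> r\<inverse>) P" by auto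
  then show ?case using Suc by (meson Suc_lessD rtrancl.rtrancl_into_rtrancl)
qed simp

lemma connected: "connected_poset P r"
  unfolding connected_poset_def
proof (intro conjI ballI)
  show "P \<noteq> {}" using vs by auto
  fix x y assume "x \<in> P" "y \<in> P"
  then have "(vs ! 0, x) \<in> (Restr (r \<union> r\<inverse>) P)\<^sup>*" "(vs ! 0, y) \<in> (Restr (r \<union> r\<inverse>) P)\<^sup>*"
    using nth_connected[OF pos(1)] pos(2) by metis+
  moreover have "sym ((Restr (r \<union> r\<inverse>) P)\<^sup>*)" by (intro sym_rtrancl) (auto simp: sym_def)
  ultimately show "(x, y) \<in> (Restr (r \<union> r\<inverse>) P)\<^sup>*" by (meson rtrancl_trans symD)
qed

lemma type_A: "type_A_poset P r"
proof (rule type_A_if_positions[of pos, OF connected])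
  show "inj_on pos M" using pos(2) M_in by (metis inj_onI)
  show "x \<preceq> y" if "z \<in> M" "x \<preceq> z" "y \<preceq> z" "pos x \<le> pos y" "pos y \<le> pos z" for x y z
  proof (cases "pos x = pos y")
    case True
    then show ?thesis using that pos(2) le_in le_refl by metis
  next
    case False
    have P: "x \<in> P" "y \<in> P" using that le_in by auto
    have "(x, z) \<in> (arcs_ends Q)\<^sup>*" using sink_path that max_iff_sink by blast
    \<comment> \<open>The walk from \<open>x\<close> to \<open>z\<close> in \<open>Q\<close> does
      not turn, so it passes through \<open>y\<close>; its initial part shows
      \<open>x \<preceq> y\<close>.\<close>
    then have "\<forall>k. pos x \<le> k \<and> k < pos z \<longrightarrow> up k"
      using path_shape_pos(2)[of x z] P that False by auto
    then have "(x, y) \<in> (arcs_ends Q)\<^sup>*"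
      using up_path[of "pos x" "pos y"] that P pos(2) by auto
    then show ?thesis using Q_path_le P by blast
  qed
  show "x \<preceq> y" if "z \<in> M" "x \<preceq> z" "y \<preceq> z" "pos z \<le> pos y" "pos y \<le> pos x" for x y z
  proof (cases "pos x = pos y")
    case True
    then show ?thesis using that pos(2) le_in le_refl by metis
  next
    case False
    have P: "x \<in> P" "y \<in> P" using that le_in by auto
    have "(x, z) \<in> (arcs_ends Q)\<^sup>*" using sink_path that max_iff_sink by blast
    then have "\<forall>k. pos z \<le> k \<and> k < pos x \<longrightarrow> down k"
      using path_shape_pos(2)[of x z] P that False by auto
    then have "(x, y) \<in> (arcs_ends Q)\<^sup>*"
      using down_path[of "pos y" "pos x"] that P pos(2) by auto
    then show ?thesis using Q_path_le P by blast
  qed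
  show "pos z < pos x \<and> pos x < pos z' \<and> (\<forall>y. y \<preceq> x \<longrightarrow> y = x)"
    if "z \<in> M" "z' \<in> M" "x \<preceq> z" "x \<preceq> z'" "pos z < pos z'" for x z z'
  proof -
    have "is_sink Q z" "is_sink Q z'" "(x, z) \<in> (arcs_ends Q)\<^sup>*" "(x, z') \<in> (arcs_ends Q)\<^sup>*" "x \<in> P"
      using that max_iff_sink sink_path le_in by auto
    then show ?thesis
      using sink_between[of z z' x] source_minimal[of x] that(5) by auto
  qed
qed

end

theorem proposition3p8:
  fixes P :: "'a set" and r :: "'a rel"
  assumes "finite P" and "partial_order_on P r"
  shows "poset_type_A P r \<longleftrightarrow>
    (\<exists>(Q :: ('a, nat) pre_digraph) F s t.
       dynkin_quiver_A Q \<and> alien_set Q F s t \<and>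
       P = verts (add_arrows Q F s t) \<and> r = quiver_order (add_arrows Q F s t))"
proof
  assume "poset_type_A P r"
  then interpret type_A_poset P r by (simp add: poset_type_A_iff)
  obtain vs where vs: "vs \<noteq> []" "distinct vs" "set vs = P" "successively comparable vs"
    "\<And>z. z \<in> M \<Longrightarrow> block vs z"
    by (rule arrangement) (rule that)
  interpret arranged_poset P r vs
    by unfold_locales (fact vs)+
  have "dynkin_quiver_A Q" using path_enumeration_Q by (auto simp: dynkin_quiver_A_def)
  then show "\<exists>(Q :: ('a, nat) pre_digraph) F s t. dynkin_quiver_A Q \<and> alien_set Q F s t \<and>
       P = verts (add_arrows Q F s t) \<and> r = quiver_order (add_arrows Q F s t)"
    using quiver_presentation by blast
next
  assume "\<exists>(Q :: ('a, nat) pre_digraph) F s t. dynkin_quiver_A Q \<and> alien_set Q F s t \<and>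
       P = verts (add_arrows Q F s t) \<and> r = quiver_order (add_arrows Q F s t)"
  then obtain Q :: "('a, nat) pre_digraph" and F s t where
    Q: "dynkin_quiver_A Q" "alien_set Q F s t"
      "P = verts (add_arrows Q F s t)" "r = quiver_order (add_arrows Q F s t)"
    by (elim exE conjE)
  obtain vs where "path_enumeration Q vs" using Q(1) by (auto simp: dynkin_quiver_A_def)
  then interpret alien_quiver P r Q F s t vs
    using assms Q by unfold_locales simp_all
  show "poset_type_A P r" using type_A by (simp add: poset_type_A_iff)
qed

end
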